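(* Let $M^n=\overline M^p\times_f\widetilde M^{n-p}$ be a warped product manifold satisfying $R\cdot R=Q(S,R)$. Then either (i) the base $\overline M$ is flat, or (ii) the fiber $\widetilde M$ is Einstein.
   Context: Setting. $(\overline M,\overline g)$ and $(\widetilde M,\widetilde g)$ are smooth semi-Riemannian manifolds of dimensions $p$ and $n-p$, $1\le p\le n-1$, $n\ge3$; $f$ is a positive smooth function on $\overline M$. The warped product $M=\overline M\times_f\widetilde M$ is the product manifold (assumed connected) with metric $g=\pi^*\overline g+(f\circ\pi)\,\sigma^*\widetilde g$, where $\pi,\sigma$ are the projections to the base $\overline M$ and the fiber $\widetilde M$. $R$ and $S$ are the curvature and Ricci tensors of $g$. Curvature. $\mathcal R(X,Y)Z=\nabla_X\nabla_YZ-\nabla_Y\nabla_XZ-\nabla_{[X,Y]}Z$, $R(X,Y,Z,W)=g(\mathcal R(X,Y)Z,W)$, $S_{jk}=g^{il}R_{ijkl}$. Derivation tensors. For a $(0,k)$-tensor $H$ and a symmetric $(0,2)$-tensor $A$, $$(R\cdot H)(X_1,\dots,X_k,X,Y)=-H(\mathcal R(X,Y)X_1,X_2,\dots,X_k)-\cdots-H(X_1,\dots,\mathcal R(X,Y)X_k),$$ $$Q(A,H)(X_1,\dots,X_k,X,Y)=\sum_{i=1}^k\big[A(X,X_i)H(X_1,\dots,Y,\dots,X_k)-A(Y,X_i)H(X_1,\dots,X,\dots,X_k)\big],$$ with $Y$ (resp. $X$) in the $i$-th slot. Flat means that the curvature tensor $\overline R$ of $\overline g$ vanishes identically. Einstein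 means $\widetilde S=\frac{\widetilde\kappa}{n-p}\widetilde g$ on $\widetilde M$, where $\widetilde S,\widetilde\kappa$ are the Ricci tensor and scalar curvature of $\widetilde g$ (no constancy of $\widetilde\kappa$ is required). *)

theory Defs
  imports "HOL-Analysis.Analysis"
begin

section \<open>Smooth manifolds\<close>

text \<open>
  \<open>Ck k S f\<close>: on the open set \<open>S\<close> the function \<open>f\<close> is \<open>k\<close> times differentiable and all iterated
  directional derivatives of order at most \<open>k\<close> are continuous.
\<close>

primrec Ck :: "nat \<Rightarrow> 'e::euclidean_space set \<Rightarrow> ('e \<Rightarrow> 'h::real_normed_vector) \<Rightarrow> bool" where
  "Ck 0 S f \<longleftrightarrow> continuous_on S f"
| "Ck (Suc k) S f \<longleftrightarrow> continuous_on S f \<and> (\<forall>z\<in>S. f differentiable (at z)) \<and>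
     (\<forall>v. Ck k S (\<lambda>z. frechet_derivative f (at z) v))"

definition smooth_on :: "'e::euclidean_space set \<Rightarrow> ('e \<Rightarrow> 'h::real_normed_vector) \<Rightarrow> bool" where
  "smooth_on S f \<longleftrightarrow> (\<forall>k. Ck k S f)"

text \<open>
  The atlas is an indexed family of charts \<open>chart_map M i\<close>, defined on \<open>chart_dom M i\<close> and taking
  values in the model space \<open>'e\<close>; the dimension is \<open>DIM('e)\<close>. Outside \<open>chart_dom M i\<close> the
  values of \<open>chart_map M i\<close> are irrelevant.
\<close>

record ('i, 'a, 'e) manifold =
  man_top :: "'a topology"
  charts :: "'i set"
  chart_dom :: "'i \<Rightarrow> 'a set"
  chart_map :: "'i \<Rightarrow> 'a \<Rightarrow> 'e"

definition chart_inv :: "('i, 'a, 'e) manifold \<Rightarrow> 'i \<Rightarrow> 'e \<Rightarrow> 'a" where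
  "chart_inv M i = inv_into (chart_dom M i) (chart_map M i)"

definition chart_img :: "('i, 'a, 'e) manifold \<Rightarrow> 'i \<Rightarrow> 'e set" where
  "chart_img M i = chart_map M i ` chart_dom M i"

definition smooth_manifold :: "('i, 'a, 'e::euclidean_space) manifold \<Rightarrow> bool" where
  "smooth_manifold M \<longleftrightarrow>
     Hausdorff_space (man_top M) \<and> second_countable (man_top M) \<and>
     (\<Union>i\<in>charts M. chart_dom M i) = topspace (man_top M) \<and>
     (\<forall>i\<in>charts M. openin (man_top M) (chart_dom M i) \<and> open (chart_img M i) \<and>
        homeomorphic_map (subtopology (man_top M) (chart_dom M i))
          (top_of_set (chart_img M i)) (chart_map M i)) \<and>
     (\<forall>i\<in>charts M. \<forall>j\<in>charts M.
        smooth_on (chart_map M i ` (chart_dom M i \<inter> chart_dom M j))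
          (chart_map M j \<circ> chart_inv M i))"

definition smooth_function :: "('i, 'a, 'e::euclidean_space) manifold \<Rightarrow> ('a \<Rightarrow> real) \<Rightarrow> bool" where
  "smooth_function M f \<longleftrightarrow> (\<forall>i\<in>charts M. smooth_on (chart_img M i) (f \<circ> chart_inv M i))"

definition product_manifold ::
  "('i, 'a, 'e) manifold \<Rightarrow> ('j, 'b, 'f) manifold \<Rightarrow> ('i \<times> 'j, 'a \<times> 'b, 'e \<times> 'f) manifold" where
  "product_manifold M N =
     \<lparr>man_top = prod_topology (man_top M) (man_top N),
      charts = charts M \<times> charts N,
      chart_dom = (\<lambda>(i, j). chart_dom M i \<times> chart_dom N j),
      chart_map = (\<lambda>(i, j). map_prod (chart_map M i) (chart_map N j))\<rparr>"

text \<open>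
  The differential of \<open>F : M \<rightarrow> N\<close> at \<open>x\<close>, expressed in the chart \<open>i\<close> around \<open>x\<close> and the
  chart \<open>k\<close> around \<open>F x\<close>.
\<close>

definition local_differential ::
  "('i, 'a, 'e::euclidean_space) manifold \<Rightarrow> ('j, 'b, 'f::euclidean_space) manifold \<Rightarrow>
   ('a \<Rightarrow> 'b) \<Rightarrow> 'i \<Rightarrow> 'j \<Rightarrow> 'a \<Rightarrow> 'e \<Rightarrow> 'f" where
  "local_differential M N F i k x =
     frechet_derivative (chart_map N k \<circ> F \<circ> chart_inv M i) (at (chart_map M i x))"

section \<open>Semi-Riemannian metrics\<close>

text \<open>
  A \<open>(0,2)\<close>-tensor field is represented by its components in the charts: \<open>g i x u v\<close> is the value
  of \<open>g\<close> at \<open>x\<close> on the tangent vectors whose coordinate vectors in the chart \<open>i\<close> are \<open>u\<close> and \<open>v\<close>.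
  Only arguments with \<open>i \<in> charts M\<close> and \<open>x \<in> chart_dom M i\<close> matter, and the components in
  overlapping charts are related by the usual transformation law.
\<close>

type_synonym ('i, 'a, 'e) tensor2 = "'i \<Rightarrow> 'a \<Rightarrow> 'e \<Rightarrow> 'e \<Rightarrow> real"

definition form_index :: "('e::euclidean_space \<Rightarrow> 'e \<Rightarrow> real) \<Rightarrow> nat" where
  "form_index B = Max {dim W | W. subspace W \<and> (\<forall>w\<in>W. w \<noteq> 0 \<longrightarrow> B w w < 0)}"

definition semi_riemannian_metric ::
  "('i, 'a, 'e::euclidean_space) manifold \<Rightarrow> ('i, 'a, 'e) tensor2 \<Rightarrow> bool" where
  "semi_riemannian_metric M g \<longleftrightarrow>
     (\<forall>i\<in>charts M. \<forall>x\<in>chart_dom M i.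
        bilinear (g i x) \<and> (\<forall>u v. g i x u v = g i x v u) \<and>
        (\<forall>u. (\<forall>v. g i x u v = 0) \<longrightarrow> u = 0)) \<and>
     (\<forall>i\<in>charts M. \<forall>j\<in>charts M. \<forall>x\<in>chart_dom M i \<inter> chart_dom M j. \<forall>u v.
        g i x u v = g j x (local_differential M M id i j x u) (local_differential M M id i j x v)) \<and>
     (\<forall>i\<in>charts M. \<forall>u v. smooth_on (chart_img M i) (\<lambda>z. g i (chart_inv M i z) u v)) \<and>
     (\<exists>\<nu>. \<forall>i\<in>charts M. \<forall>x\<in>chart_dom M i. form_index (g i x) = \<nu>)"

definition semi_riemannian_manifold ::
  "('i, 'a, 'e::euclidean_space) manifold \<Rightarrow> ('i, 'a, 'e) tensor2 \<Rightarrow> bool" where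
  "semi_riemannian_manifold M g \<longleftrightarrow> smooth_manifold M \<and> semi_riemannian_metric M g"

text \<open>By the transformation law the choice of the chart \<open>k\<close> around \<open>F x\<close> is immaterial.\<close>

definition pullback ::
  "('i, 'a, 'e::euclidean_space) manifold \<Rightarrow> ('j, 'b, 'f::euclidean_space) manifold \<Rightarrow>
   ('a \<Rightarrow> 'b) \<Rightarrow> ('j, 'b, 'f) tensor2 \<Rightarrow> ('i, 'a, 'e) tensor2" where
  "pullback M N F h i x u v =
     (let k = (SOME k. k \<in> charts N \<and> F x \<in> chart_dom N k)
      in h k (F x) (local_differential M N F i k x u) (local_differential M N F i k x v))"

definition warped_metric ::
  "('i, 'a, 'e::euclidean_space) manifold \<Rightarrow> ('j, 'b, 'f::euclidean_space) manifold \<Rightarrow>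
   ('i, 'a, 'e) tensor2 \<Rightarrow> ('j, 'b, 'f) tensor2 \<Rightarrow> ('a \<Rightarrow> real) \<Rightarrow>
   ('i \<times> 'j, 'a \<times> 'b, 'e \<times> 'f) tensor2" where
  "warped_metric M N g h f = (\<lambda>i x u v.
     pullback (product_manifold M N) M fst g i x u v +
     (f \<circ> fst) x * pullback (product_manifold M N) N snd h i x u v)"

section \<open>Levi-Civita connection and curvature in a chart\<close>

text \<open>
  In this section \<open>G z\<close> is the bilinear form of the metric at the coordinate point \<open>z\<close>, and vector
  fields are given by their coordinate functions \<open>'e \<Rightarrow> 'e\<close>.
\<close>

text \<open>
  In a chart every connection has the form \<open>\<nabla>\<^sub>X Y = DY(X) + \<Gamma>(X, Y)\<close> with \<open>\<Gamma>\<close> bilinear at each point,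
  so that \<open>\<nabla>\<^sub>X Y - \<nabla>\<^sub>Y X - [X, Y] = \<Gamma>(X, Y) - \<Gamma>(Y, X)\<close> and
  \<open>X(G(Y, Z)) - G(\<nabla>\<^sub>X Y, Z) - G(Y, \<nabla>\<^sub>X Z) = (DG(X))(Y, Z) - G(\<Gamma>(X, Y), Z) - G(Y, \<Gamma>(X, Z))\<close>.
  Hence the two clauses after bilinearity say that \<open>\<nabla>\<close> is torsion-free and metric. As usual there is
  exactly one such \<open>\<Gamma>\<close> when \<open>G\<close> is symmetric, differentiable and nondegenerate.
\<close>

definition christoffel :: "('e::euclidean_space \<Rightarrow> 'e \<Rightarrow> 'e \<Rightarrow> real) \<Rightarrow> 'e \<Rightarrow> 'e \<Rightarrow> 'e \<Rightarrow> 'e" where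
  "christoffel G z = (THE \<Gamma>. bilinear \<Gamma> \<and>
     (\<forall>u v. \<Gamma> u v = \<Gamma> v u) \<and>
     (\<forall>u v w. frechet_derivative (\<lambda>y. G y v w) (at z) u = G z (\<Gamma> u v) w + G z v (\<Gamma> u w)))"

definition covariant_derivative ::
  "('e::euclidean_space \<Rightarrow> 'e \<Rightarrow> 'e \<Rightarrow> real) \<Rightarrow> ('e \<Rightarrow> 'e) \<Rightarrow> ('e \<Rightarrow> 'e) \<Rightarrow> 'e \<Rightarrow> 'e" where
  "covariant_derivative G X Y =
     (\<lambda>z. frechet_derivative Y (at z) (X z) + christoffel G z (X z) (Y z))"

definition lie_bracket ::
  "('e::euclidean_space \<Rightarrow> 'e) \<Rightarrow> ('e \<Rightarrow> 'e) \<Rightarrow> 'e \<Rightarrow> 'e" where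
  "lie_bracket X Y =
     (\<lambda>z. frechet_derivative Y (at z) (X z) - frechet_derivative X (at z) (Y z))"

definition curvature_of_fields ::
  "('e::euclidean_space \<Rightarrow> 'e \<Rightarrow> 'e \<Rightarrow> real) \<Rightarrow> ('e \<Rightarrow> 'e) \<Rightarrow> ('e \<Rightarrow> 'e) \<Rightarrow> ('e \<Rightarrow> 'e) \<Rightarrow> 'e \<Rightarrow> 'e" where
  "curvature_of_fields G X Y Z =
     (\<lambda>z. covariant_derivative G X (covariant_derivative G Y Z) z
        - covariant_derivative G Y (covariant_derivative G X Z) z
        - covariant_derivative G (lie_bracket X Y) Z z)"

text \<open>
  The curvature is a tensor, so its value on tangent vectors may be computed with any extensions to
  local vector fields; we extend by constant coordinates.
\<close>

definition curvature_operator ::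
  "('e::euclidean_space \<Rightarrow> 'e \<Rightarrow> 'e \<Rightarrow> real) \<Rightarrow> 'e \<Rightarrow> 'e \<Rightarrow> 'e \<Rightarrow> 'e \<Rightarrow> 'e" where
  "curvature_operator G z u v w = curvature_of_fields G (\<lambda>_. u) (\<lambda>_. v) (\<lambda>_. w) z"

text \<open>
  \<open>g\<^sup>i\<^sup>l\<close>: the inverse of the Gram matrix with respect to \<open>Basis\<close>, with rows and columns indexed by
  the basis vectors themselves (and set to zero elsewhere to make it unique).
\<close>

definition inverse_metric :: "('e::euclidean_space \<Rightarrow> 'e \<Rightarrow> real) \<Rightarrow> 'e \<Rightarrow> 'e \<Rightarrow> real" where
  "inverse_metric B = (THE h.
     (\<forall>a b. a \<notin> Basis \<or> b \<notin> Basis \<longrightarrow> h a b = 0) \<and>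
     (\<forall>a\<in>Basis. \<forall>c\<in>Basis. (\<Sum>b\<in>Basis. h a b * B b c) = (if a = c then 1 else 0)))"

section \<open>Curvature tensors on the manifold\<close>

text \<open>As for metrics, tensors are given by their components in the chart \<open>i\<close> at the point \<open>x\<close>.\<close>

definition curv_op ::
  "('i, 'a, 'e::euclidean_space) manifold \<Rightarrow> ('i, 'a, 'e) tensor2 \<Rightarrow> 'i \<Rightarrow> 'a \<Rightarrow> 'e \<Rightarrow> 'e \<Rightarrow> 'e \<Rightarrow> 'e" where
  "curv_op M g i x = curvature_operator (\<lambda>z. g i (chart_inv M i z)) (chart_map M i x)"

definition curv ::
  "('i, 'a, 'e::euclidean_space) manifold \<Rightarrow> ('i, 'a, 'e) tensor2 \<Rightarrow>
   'i \<Rightarrow> 'a \<Rightarrow> 'e \<Rightarrow> 'e \<Rightarrow> 'e \<Rightarrow> 'e \<Rightarrow> real" where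
  "curv M g i x u v w t = g i x (curv_op M g i x u v w) t"

definition ricci ::
  "('i, 'a, 'e::euclidean_space) manifold \<Rightarrow> ('i, 'a, 'e) tensor2 \<Rightarrow> ('i, 'a, 'e) tensor2" where
  "ricci M g i x v w =
     (\<Sum>a\<in>Basis. \<Sum>b\<in>Basis. inverse_metric (g i x) a b * curv M g i x a v w b)"

definition scalar_curvature ::
  "('i, 'a, 'e::euclidean_space) manifold \<Rightarrow> ('i, 'a, 'e) tensor2 \<Rightarrow> 'i \<Rightarrow> 'a \<Rightarrow> real" where
  "scalar_curvature M g i x =
     (\<Sum>a\<in>Basis. \<Sum>b\<in>Basis. inverse_metric (g i x) a b * ricci M g i x a b)"

definition flat :: "('i, 'a, 'e::euclidean_space) manifold \<Rightarrow> ('i, 'a, 'e) tensor2 \<Rightarrow> bool" where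
  "flat M g \<longleftrightarrow>
     (\<forall>i\<in>charts M. \<forall>x\<in>chart_dom M i. \<forall>u v w t. curv M g i x u v w t = 0)"

definition einstein :: "('i, 'a, 'e::euclidean_space) manifold \<Rightarrow> ('i, 'a, 'e) tensor2 \<Rightarrow> bool" where
  "einstein M g \<longleftrightarrow>
     (\<forall>i\<in>charts M. \<forall>x\<in>chart_dom M i. \<forall>u v.
        ricci M g i x u v = scalar_curvature M g i x / real DIM('e) * g i x u v)"

section \<open>Derivation tensors\<close>

text \<open>
  A \<open>(0,k)\<close>-tensor at a point is a function of the list (of length \<open>k\<close>) of its arguments. In
  \<open>derivation_tensor\<close> the argument \<open>\<R>\<close> is the curvature operator, so that
  \<open>derivation_tensor \<R> H [X1, ..., Xk] X Y\<close> is \<open>(R \<cdot> H)(X1, ..., Xk, X, Y)\<close>; likewise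
  \<open>tachibana_tensor A H [X1, ..., Xk] X Y\<close> is \<open>Q(A, H)(X1, ..., Xk, X, Y)\<close>.
\<close>

definition derivation_tensor ::
  "('e \<Rightarrow> 'e \<Rightarrow> 'e \<Rightarrow> 'e) \<Rightarrow> ('e list \<Rightarrow> real) \<Rightarrow> 'e list \<Rightarrow> 'e \<Rightarrow> 'e \<Rightarrow> real" where
  "derivation_tensor \<R> H Xs X Y = - (\<Sum>i<length Xs. H (Xs[i := \<R> X Y (Xs ! i)]))"

definition tachibana_tensor ::
  "('e \<Rightarrow> 'e \<Rightarrow> real) \<Rightarrow> ('e list \<Rightarrow> real) \<Rightarrow> 'e list \<Rightarrow> 'e \<Rightarrow> 'e \<Rightarrow> real" where
  "tachibana_tensor A H Xs X Y =
     (\<Sum>i<length Xs. A X (Xs ! i) * H (Xs[i := Y]) - A Y (Xs ! i) * H (Xs[i := X]))"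

definition tensor4 :: "('e \<Rightarrow> 'e \<Rightarrow> 'e \<Rightarrow> 'e \<Rightarrow> real) \<Rightarrow> 'e list \<Rightarrow> real" where
  "tensor4 T Xs = T (Xs ! 0) (Xs ! 1) (Xs ! 2) (Xs ! 3)"

definition RR_eq_QSR ::
  "('i, 'a, 'e::euclidean_space) manifold \<Rightarrow> ('i, 'a, 'e) tensor2 \<Rightarrow> bool" where
  "RR_eq_QSR M g \<longleftrightarrow>
     (\<forall>i\<in>charts M. \<forall>x\<in>chart_dom M i. \<forall>Xs X Y. length Xs = 4 \<longrightarrow>
        derivation_tensor (curv_op M g i x) (tensor4 (curv M g i x)) Xs X Y =
        tachibana_tensor (ricci M g i x) (tensor4 (curv M g i x)) Xs X Y)"

end

theory Submission
  imports Defs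
begin

text \<open>
  The statement is local in the base and in the fiber. Suppose that the base has a nonzero curvature
  component \<open>R(a, b, c, d)\<close> at a point \<open>x\<close>, and let \<open>y\<close> be any point of the fiber. At \<open>(x, y)\<close> the
  condition \<open>R \<cdot> R = Q(S, R)\<close> is evaluated on \<open>(\<alpha>, b, c, d; a, \<beta>)\<close>, where \<open>\<alpha>\<close>, \<open>\<beta>\<close> are tangent to the
  fiber. The structure of the curvature of a warped product makes every term a multiple of the
  fiber metric \<open>h(\<beta>, \<alpha>)\<close>, with a factor that depends on the base vectors only, except for
  \<open>S(\<beta>, \<alpha>) R(a, b, c, d)\<close> (\<open>ricci_fiber_times_base_curvature\<close>). As \<open>R(a, b, c, d) \<noteq> 0\<close>, the restriction
  of \<open>S\<close> to the fiber directions is a multiple of \<open>h\<close>. That restriction is the Ricci tensor of the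
  fiber plus a multiple of \<open>h\<close> (\<open>ricci_fiber\<close>), so the Ricci tensor of the fiber at \<open>y\<close> is a multiple
  of \<open>h\<close>, and the trace shows that the factor is the scalar curvature over the dimension.

  The curvature components are computed in product charts, where the metric is
  \<open>g + f h\<close> in block form (\<open>warped_metric_product_chart\<close>). The Christoffel symbols of the warped
  product are guessed and confirmed by uniqueness of the Levi-Civita connection (\<open>christoffel_G\<close>).
  Differentiating them requires that the Christoffel symbols of the factors and the gradient of \<open>f\<close>,
  which are given only implicitly by the metric, depend differentiably on the point
  (\<open>differentiable_represented\<close>).
\<close>

section \<open>Scalar products\<close>

definition scalar_product :: "('e::euclidean_space \<Rightarrow> 'e \<Rightarrow> real) \<Rightarrow> bool" where
  "scalar_product B \<longleftrightarrow>
     bilinear B \<and> (\<forall>u v. B u v = B v u) \<and> (\<forall>u. (\<forall>v. B u v = 0) \<longrightarrow> u = 0)"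

lemma scalar_product_eqI:
  assumes "scalar_product B" "\<And>v. B u v = B w v"
  shows "u = w"
proof -
  have "bilinear B"
    using assms(1) by (simp add: scalar_product_def)
  then have "\<forall>v. B (u - w) v = 0"
    using assms(2) by (metis bilinear_lsub diff_self)
  then have "u - w = 0"
    using assms(1) unfolding scalar_product_def by blast
  then show ?thesis by simp
qed

lemma bilinear_Basis_expand:
  fixes B :: "'e::euclidean_space \<Rightarrow> 'b::real_vector \<Rightarrow> 'c::real_vector"
  assumes "bilinear B"
  shows "B u v = (\<Sum>b\<in>Basis. (u \<bullet> b) *\<^sub>R B b v)"
proof -
  have l: "linear (\<lambda>x. B x v)"
    using assms by (simp add: bilinear_def)
  have "B u v = B (\<Sum>b\<in>Basis. (u \<bullet> b) *\<^sub>R b) v"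
    by (simp add: euclidean_representation)
  also have "\<dots> = (\<Sum>b\<in>Basis. (u \<bullet> b) *\<^sub>R B b v)"
    by (simp add: linear_sum[OF l] linear_cmul[OF l])
  finally show ?thesis .
qed

lemma linear_Basis_expand:
  fixes l :: "'e::euclidean_space \<Rightarrow> 'c::real_vector"
  assumes "linear l"
  shows "l u = (\<Sum>b\<in>Basis. (u \<bullet> b) *\<^sub>R l b)"
proof -
  have "l u = l (\<Sum>b\<in>Basis. (u \<bullet> b) *\<^sub>R b)"
    by (simp add: euclidean_representation)
  also have "\<dots> = (\<Sum>b\<in>Basis. (u \<bullet> b) *\<^sub>R l b)"
    by (simp add: linear_sum[OF assms] linear_cmul[OF assms])
  finally show ?thesis .
qed

text \<open>
  In finite dimension the map \<open>w \<mapsto> B w\<close> into the dual space is injective by nondegeneracy and hence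
  surjective; \<open>A\<close> below is this map after identifying the dual space by the Euclidean inner product.
\<close>

lemma scalar_product_represents:
  assumes B: "scalar_product B" and l: "linear l"
  shows "\<exists>w. \<forall>v. B w v = l v"
proof -
  have bil: "bilinear B"
    using B by (simp add: scalar_product_def)
  define A where "A w = (\<Sum>b\<in>Basis. B w b *\<^sub>R b)" for w
  have A_Basis: "A w \<bullet> b = B w b" if "b \<in> Basis" for w b
    using that by (simp add: A_def)
  have linA: "linear A"
    unfolding A_def using bil
    by (intro linearI)
      (simp_all add: bilinear_ladd bilinear_lmul scaleR_add_left sum.distrib scaleR_sum_right)
  have eq: "B w v = A w \<bullet> v" for w v
  proof -
    have "B w v = (\<Sum>b\<in>Basis. (v \<bullet> b) *\<^sub>R B w b)"
      using bil by (intro linear_Basis_expand) (simp add: bilinear_def)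
    also have "\<dots> = (\<Sum>b\<in>Basis. (A w \<bullet> b) * (v \<bullet> b))"
      by (simp add: A_Basis mult.commute)
    also have "\<dots> = A w \<bullet> v"
      by (rule euclidean_inner[symmetric])
    finally show ?thesis .
  qed
  have "inj A"
  proof (rule injI)
    fix x y assume "A x = A y"
    then have "B x v = B y v" for v by (simp add: eq)
    then show "x = y" by (rule scalar_product_eqI[OF B])
  qed
  then have "surj A"
    using linA linear_injective_imp_surjective by blast
  then obtain w where w: "A w = (\<Sum>b\<in>Basis. l b *\<^sub>R b)"
    by (metis surj_def)
  have "B w v = l v" for v
  proof -
    have "B w v = (\<Sum>b\<in>Basis. (A w \<bullet> b) * (v \<bullet> b))"
      unfolding eq by (rule euclidean_inner)
    also have "\<dots> = (\<Sum>b\<in>Basis. (v \<bullet> b) *\<^sub>R l b)"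
      by (simp add: w mult.commute)
    also have "\<dots> = l v"
      by (rule linear_Basis_expand[OF l, symmetric])
    finally show ?thesis .
  qed
  then show ?thesis by blast
qed

definition sharp :: "('e::euclidean_space \<Rightarrow> 'e \<Rightarrow> real) \<Rightarrow> ('e \<Rightarrow> real) \<Rightarrow> 'e" where
  "sharp B l = (SOME w. \<forall>v. B w v = l v)"

lemma sharp:
  assumes "scalar_product B" "linear l"
  shows "B (sharp B l) v = l v"
  using someI_ex[OF scalar_product_represents[OF assms]] by (simp add: sharp_def)

lemma inverse_metric:
  fixes B :: "'e::euclidean_space \<Rightarrow> 'e \<Rightarrow> real"
  assumes B: "scalar_product B" and a: "a \<in> Basis" and c: "c \<in> Basis"
  shows "(\<Sum>b\<in>Basis. inverse_metric B a b * B b c) = (if a = c then 1 else 0)"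
proof -
  have bil: "bilinear B"
    using B by (simp add: scalar_product_def)
  define s where "s a = sharp B (\<lambda>v. v \<bullet> a)" for a
  have s: "B (s a) v = v \<bullet> a" for a v
    unfolding s_def
    by (rule sharp[OF B, of "\<lambda>v. v \<bullet> a"]) (simp add: bounded_linear.linear[OF bounded_linear_inner_left])
  define P where "P h \<longleftrightarrow> (\<forall>a b. a \<notin> Basis \<or> b \<notin> Basis \<longrightarrow> h a b = 0) \<and>
     (\<forall>a\<in>Basis. \<forall>c\<in>Basis. (\<Sum>b\<in>Basis. h a b * B b c) = (if a = c then 1 else 0))"
    for h :: "'e \<Rightarrow> 'e \<Rightarrow> real"
  define h0 where "h0 a b = (if a \<in> Basis \<and> b \<in> Basis then s a \<bullet> b else 0)" for a b
  have "P h0"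
    unfolding P_def
  proof (intro conjI ballI)
    fix a c :: 'e assume ac: "a \<in> Basis" "c \<in> Basis"
    have "(\<Sum>b\<in>Basis. h0 a b * B b c) = B (s a) c"
      using ac by (subst bilinear_Basis_expand[OF bil]) (simp add: h0_def)
    also have "\<dots> = (if a = c then 1 else 0)"
      using ac by (auto simp: s inner_Basis)
    finally show "(\<Sum>b\<in>Basis. h0 a b * B b c) = (if a = c then 1 else 0)" .
  qed (auto simp: h0_def)
  moreover have "h = h0" if "P h" for h
  proof (intro ext)
    fix a b
    show "h a b = h0 a b"
    proof (cases "a \<in> Basis \<and> b \<in> Basis")
      case True
      define w where "w = (\<Sum>b\<in>Basis. h a b *\<^sub>R b)"
      have "B w c = B (s a) c" if "c \<in> Basis" for c
      proof -
        have "B w c = (\<Sum>b\<in>Basis. h a b * B b c)"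
          by (subst bilinear_Basis_expand[OF bil]) (simp add: w_def)
        also have "\<dots> = c \<bullet> a"
          using that True \<open>P h\<close> by (simp add: P_def inner_Basis)
        finally show ?thesis by (simp add: s)
      qed
      then have "B w v = B (s a) v" for v
        using bil by (subst (1 2) linear_Basis_expand[where u = v]) (simp_all add: bilinear_def)
      then have "w = s a"
        by (rule scalar_product_eqI[OF B])
      moreover have "w \<bullet> b = h a b"
        using True by (simp add: w_def)
      ultimately show ?thesis
        using True by (simp add: h0_def)
    next
      case False
      then show ?thesis using \<open>P h\<close> by (auto simp: P_def h0_def)
    qed
  qed
  ultimately have "P (inverse_metric B)"
    unfolding inverse_metric_def P_def[symmetric] by (metis theI)
  then show ?thesis using a c by (simp add: P_def)
qed

text \<open>
  Contracting with the inverse metric is taking a trace. In this form the Ricci tensors of the warped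
  product and of the fiber can be compared without relating their inverse metrics.
\<close>

lemma metric_contraction:
  fixes B :: "'e::euclidean_space \<Rightarrow> 'e \<Rightarrow> real"
  assumes B: "scalar_product B"
  shows "(\<Sum>a\<in>Basis. \<Sum>b\<in>Basis. inverse_metric B a b * B (L a) b) = (\<Sum>a\<in>Basis. L a \<bullet> a)"
proof (rule sum.cong[OF refl])
  fix a :: 'e assume a: "a \<in> Basis"
  have bil: "bilinear B" and sym: "\<And>u v. B u v = B v u"
    using B by (auto simp: scalar_product_def)
  have "(\<Sum>b\<in>Basis. inverse_metric B a b * B (L a) b)
      = (\<Sum>b\<in>Basis. \<Sum>c\<in>Basis. (L a \<bullet> c) * (inverse_metric B a b * B b c))"
    by (subst bilinear_Basis_expand[OF bil])
      (simp add: sum_distrib_left sym[of _ "_::'e"] mult.left_commute)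
  also have "\<dots> = (\<Sum>c\<in>Basis. (L a \<bullet> c) * (\<Sum>b\<in>Basis. inverse_metric B a b * B b c))"
    by (subst sum.swap) (simp add: sum_distrib_left)
  also have "\<dots> = (\<Sum>c\<in>Basis. (L a \<bullet> c) * (if a = c then 1 else 0))"
    using inverse_metric[OF B a] by simp
  also have "\<dots> = L a \<bullet> a"
    using a by (simp add: if_distrib cong: if_cong)
  finally show "(\<Sum>b\<in>Basis. inverse_metric B a b * B (L a) b) = L a \<bullet> a" .
qed

section \<open>Differentiating the solution of a linear system\<close>

text \<open>
  Where the first factor vanishes the product rule asks only for continuity of the second, since a
  derivative of the second factor would be multiplied by zero.
\<close>

lemma has_derivative_vanishing_mult:
  fixes e :: "'a::real_normed_vector \<Rightarrow> real" and g :: "'a \<Rightarrow> real"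
  assumes e: "(e has_derivative e') (at z)" and e0: "e z = 0" and g: "isCont g z"
  shows "((\<lambda>y. e y * g y) has_derivative (\<lambda>u. e' u * g z)) (at z)"
proof -
  interpret e': bounded_linear e' by (rule has_derivative_bounded_linear[OF e])
  obtain K where K0: "K > 0" and K: "\<And>u. norm (e' u) \<le> norm u * K"
    using e'.pos_bounded by blast
  have "((\<lambda>y. e y * (g y - g z)) has_derivative (\<lambda>u. 0)) (at z)"
    unfolding has_derivative_at_alt
  proof (intro conjI allI impI)
    fix r :: real assume "r > 0"
    obtain d1 where d1: "d1 > 0"
      "\<And>y. norm (y - z) < d1 \<Longrightarrow> norm (e y - e z - e' (y - z)) \<le> 1 * norm (y - z)"
      using e unfolding has_derivative_at_alt by (meson zero_less_one)
    obtain d2 where d2: "d2 > 0"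
      "\<And>y. norm (y - z) < d2 \<Longrightarrow> \<bar>g y - g z\<bar> < r / (K + 1)"
      using g \<open>r > 0\<close> K0 unfolding continuous_at_eps_delta dist_norm real_norm_def
      by (metis add_pos_pos divide_pos_pos zero_less_one)
    have "norm (e y * (g y - g z) - e z * (g z - g z) - 0) \<le> r * norm (y - z)"
      if y: "norm (y - z) < min d1 d2" for y
    proof -
      have "\<bar>e y\<bar> \<le> \<bar>e y - e z - e' (y - z)\<bar> + \<bar>e' (y - z)\<bar>"
        using e0 by simp
      also have "\<dots> \<le> (K + 1) * norm (y - z)"
        using d1(2)[of y] y K[of "y - z"] by (simp add: algebra_simps)
      finally have "\<bar>e y\<bar> * \<bar>g y - g z\<bar> \<le> ((K + 1) * norm (y - z)) * (r / (K + 1))"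
        using d2(2)[of y] y K0 by (intro mult_mono) auto
      also have "\<dots> = r * norm (y - z)"
        using K0 by (simp add: field_simps)
      finally show ?thesis
        by (simp add: e0 abs_mult)
    qed
    then show "\<exists>d>0. \<forall>y. norm (y - z) < d \<longrightarrow>
        norm (e y * (g y - g z) - e z * (g z - g z) - 0) \<le> r * norm (y - z)"
      using d1(1) d2(1) by (intro exI[of _ "min d1 d2"]) auto
  qed simp
  moreover have "((\<lambda>y. e y * g z) has_derivative (\<lambda>u. e' u * g z)) (at z)"
    using e by (rule has_derivative_mult_left)
  ultimately have "((\<lambda>y. e y * g z + e y * (g y - g z)) has_derivative (\<lambda>u. e' u * g z + 0)) (at z)"
    by (intro has_derivative_add)
  then show ?thesis
    by (simp add: algebra_simps)
qed

text \<open>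
  Inverting the metric at \<open>z\<close> turns the system for \<open>x y\<close> into a perturbation of the identity by
  coefficients \<open>E b c y\<close> that vanish at \<open>z\<close>. While they are small \<open>x\<close> is bounded by the right-hand
  side, hence continuous at \<open>z\<close>; the perturbation is then a product of differentiable coefficients
  vanishing at \<open>z\<close> with continuous functions, which is differentiable.
\<close>

lemma differentiable_represented:
  fixes G :: "'a::real_normed_vector \<Rightarrow> 'e::euclidean_space \<Rightarrow> 'e \<Rightarrow> real"
  assumes W: "open W" "z \<in> W"
    and bil: "\<And>y. y \<in> W \<Longrightarrow> bilinear (G y)"
    and B: "scalar_product (G z)"
    and dG: "\<And>v w. (\<lambda>y. G y v w) differentiable (at z)"
    and dl: "\<And>w. (\<lambda>y. l y w) differentiable (at z)"
    and eq: "\<And>y w. y \<in> W \<Longrightarrow> G y (x y) w = l y w"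
  shows "x differentiable (at z)"
proof -
  define s where "s c = sharp (G z) (\<lambda>v. v \<bullet> c)" for c
  have s: "G z (s c) v = v \<bullet> c" for c v
    unfolding s_def
    by (rule sharp[OF B, of "\<lambda>v. v \<bullet> c"]) (simp add: bounded_linear.linear[OF bounded_linear_inner_left])
  define E where "E b c y = G y b (s c) - G z b (s c)" for b c y
  have dE: "(\<lambda>y. E b c y) differentiable (at z)" for b c
    unfolding E_def by (intro derivative_intros dG)
  have E0: "E b c z = 0" for b c
    by (simp add: E_def)
  have x_c: "x y \<bullet> c = l y (s c) - (\<Sum>b\<in>Basis. E b c y * (x y \<bullet> b))" if y: "y \<in> W" for y c
  proof -
    have "x y \<bullet> c = G z (x y) (s c)"
      using s[of c "x y"] B by (simp add: scalar_product_def)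
    also have "\<dots> = G y (x y) (s c) - (G y (x y) (s c) - G z (x y) (s c))"
      by simp
    also have "G y (x y) (s c) - G z (x y) (s c) = (\<Sum>b\<in>Basis. E b c y * (x y \<bullet> b))"
    proof -
      have "bilinear (G z)"
        using B by (simp add: scalar_product_def)
      then show ?thesis
        unfolding E_def bilinear_Basis_expand[OF bil[OF y], of "x y"]
          bilinear_Basis_expand[OF \<open>bilinear (G z)\<close>, of "x y"]
        by (simp add: sum_subtractf[symmetric] algebra_simps)
    qed
    finally show ?thesis
      using eq[OF y] by simp
  qed
  define e where "e y = (\<Sum>c\<in>Basis. \<Sum>b\<in>Basis. \<bar>E b c y\<bar>)" for y
  define m where "m y = (\<Sum>c\<in>Basis. \<bar>l y (s c)\<bar>)" for y
  have contE: "isCont (E b c) z" for b c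
    using dE differentiable_imp_continuous_within by blast
  have contl: "isCont (\<lambda>y. l y w) z" for w
    using dl differentiable_imp_continuous_within by blast
  have e0: "(e \<longlongrightarrow> 0) (at z)"
  proof -
    have "isCont e z"
      unfolding e_def by (intro continuous_intros contE)
    then show ?thesis
      by (simp add: isCont_def e_def E0)
  qed
  have cm: "(m \<longlongrightarrow> m z) (at z)"
  proof -
    have "isCont m z"
      unfolding m_def by (intro continuous_intros contl)
    then show ?thesis
      by (simp add: isCont_def)
  qed
  have Wev: "\<forall>\<^sub>F y in at z. y \<in> W"
    using W by (rule eventually_at_in_open')
  have sum_le: "(\<Sum>c\<in>Basis. \<bar>\<Sum>b\<in>Basis. E b c y * (x y \<bullet> b)\<bar>) \<le> e y * norm (x y)" for y
  proof -
    have "\<bar>\<Sum>b\<in>Basis. E b c y * (x y \<bullet> b)\<bar> \<le> (\<Sum>b\<in>Basis. \<bar>E b c y\<bar>) * norm (x y)" for c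
    proof -
      have "\<bar>\<Sum>b\<in>Basis. E b c y * (x y \<bullet> b)\<bar> \<le> (\<Sum>b\<in>Basis. \<bar>E b c y\<bar> * norm (x y))"
        by (rule order_trans[OF sum_abs], rule sum_mono)
          (simp add: abs_mult Basis_le_norm mult_left_mono)
      then show ?thesis by (simp add: sum_distrib_right)
    qed
    then show ?thesis
      unfolding e_def by (subst sum_distrib_right) (rule sum_mono)
  qed
  have bound: "\<forall>\<^sub>F y in at z. norm (x y) \<le> 2 * m y"
  proof -
    have "\<forall>\<^sub>F y in at z. e y < 1 / 2"
      using e0 by (rule order_tendstoD) simp
    with Wev show ?thesis
    proof eventually_elim
      case (elim y)
      have "norm (x y) \<le> (\<Sum>c\<in>Basis. \<bar>x y \<bullet> c\<bar>)"
        by (rule norm_le_l1)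
      also have "\<dots> \<le> (\<Sum>c\<in>Basis. \<bar>l y (s c)\<bar> + \<bar>\<Sum>b\<in>Basis. E b c y * (x y \<bullet> b)\<bar>)"
        using x_c[OF elim(1)] by (intro sum_mono) (metis abs_triangle_ineq4)
      also have "\<dots> \<le> m y + e y * norm (x y)"
        using sum_le[of y] by (simp add: m_def sum.distrib)
      also have "\<dots> \<le> m y + 1 / 2 * norm (x y)"
        using elim(2) by (intro add_left_mono mult_right_mono) auto
      finally show ?case by simp
    qed
  qed
  have "((\<lambda>y. \<Sum>c\<in>Basis. \<bar>\<Sum>b\<in>Basis. E b c y * (x y \<bullet> b)\<bar>) \<longlongrightarrow> 0) (at z)"
  proof (rule tendsto_sandwich[of "\<lambda>_. 0" _ _ "\<lambda>y. e y * (2 * m y)"])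
    show "\<forall>\<^sub>F y in at z. (\<Sum>c\<in>Basis. \<bar>\<Sum>b\<in>Basis. E b c y * (x y \<bullet> b)\<bar>) \<le> e y * (2 * m y)"
      using bound
    proof eventually_elim
      case (elim y)
      have "e y \<ge> 0"
        unfolding e_def by (intro sum_nonneg) simp
      then show ?case
        using sum_le[of y] elim by (meson mult_left_mono order_trans)
    qed
    have "((\<lambda>y. e y * (2 * m y)) \<longlongrightarrow> 0 * (2 * m z)) (at z)"
      by (intro tendsto_intros e0 cm)
    then show "((\<lambda>y. e y * (2 * m y)) \<longlongrightarrow> 0) (at z)"
      by simp
  qed (auto intro: sum_nonneg)
  then have sum0: "((\<lambda>y. \<Sum>b\<in>Basis. E b c y * (x y \<bullet> b)) \<longlongrightarrow> 0) (at z)" if "c \<in> Basis" for c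
  proof (rule Lim_null_comparison[rotated], intro always_eventually allI)
    show "norm (\<Sum>b\<in>Basis. E b c y * (x y \<bullet> b)) \<le> (\<Sum>c\<in>Basis. \<bar>\<Sum>b\<in>Basis. E b c y * (x y \<bullet> b)\<bar>)" for y
      unfolding real_norm_def
      by (rule member_le_sum[OF that, where f = "\<lambda>c. \<bar>\<Sum>b\<in>Basis. E b c y * (x y \<bullet> b)\<bar>"]) simp_all
  qed
  have contx: "isCont (\<lambda>y. x y \<bullet> c) z" if c: "c \<in> Basis" for c
  proof -
    have "((\<lambda>y. l y (s c) - (\<Sum>b\<in>Basis. E b c y * (x y \<bullet> b))) \<longlongrightarrow> l z (s c) - 0) (at z)"
      using contl by (intro tendsto_diff sum0 c) (auto simp: isCont_def)
    moreover have "l z (s c) - 0 = x z \<bullet> c"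
      using x_c[OF W(2), of c] by (simp add: E0)
    moreover have "\<forall>\<^sub>F y in at z. l y (s c) - (\<Sum>b\<in>Basis. E b c y * (x y \<bullet> b)) = x y \<bullet> c"
      using Wev by eventually_elim (simp add: x_c)
    ultimately show ?thesis
      unfolding isCont_def by (auto elim: Lim_transform_eventually)
  qed
  have "(\<lambda>y. x y \<bullet> c) differentiable (at z)" if c: "c \<in> Basis" for c
  proof -
    have "(\<lambda>y. E b c y * (x y \<bullet> b)) differentiable (at z)" if "b \<in> Basis" for b
      using has_derivative_vanishing_mult[OF frechet_derivative_works[THEN iffD1, OF dE] E0 contx[OF that]]
      unfolding differentiable_def by blast
    then have "(\<lambda>y. l y (s c) - (\<Sum>b\<in>Basis. E b c y * (x y \<bullet> b))) differentiable (at z)"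
      by (intro derivative_intros dl) auto
    then obtain D where "((\<lambda>y. l y (s c) - (\<Sum>b\<in>Basis. E b c y * (x y \<bullet> b))) has_derivative D) (at z)"
      unfolding differentiable_def by blast
    then have "((\<lambda>y. x y \<bullet> c) has_derivative D) (at z)"
      using W by (rule has_derivative_transform_within_open) (simp add: x_c)
    then show ?thesis
      unfolding differentiable_def by blast
  qed
  then show ?thesis
    by (subst differentiable_componentwise_within) auto
qed

section \<open>The Levi-Civita connection in a chart\<close>

lemma frechet_derivative_cong_open:
  assumes "open U" "z \<in> U" "\<And>y. y \<in> U \<Longrightarrow> f y = g y"
  shows "frechet_derivative f (at z) = frechet_derivative g (at z)"
proof -
  have "(f has_derivative D) (at z) \<longleftrightarrow> (g has_derivative D) (at z)" for D
    using assms
    by (auto elim!: has_derivative_transform_within_open[OF _ assms(1,2)])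
  then show ?thesis
    by (simp add: frechet_derivative_def)
qed

lemma christoffel_cong_open:
  assumes "open U" "z \<in> U" "\<And>y. y \<in> U \<Longrightarrow> G y = H y"
  shows "christoffel G z = christoffel H z"
proof -
  have "frechet_derivative (\<lambda>y. G y v w) (at z) = frechet_derivative (\<lambda>y. H y v w) (at z)" for v w
    using assms by (intro frechet_derivative_cong_open[of U]) auto
  then show ?thesis
    using assms by (simp add: christoffel_def)
qed

text \<open>
  The defining property of \<^const>\<open>christoffel\<close>, named so that its uniqueness (from the Koszul formula)
  can be used to recognize Christoffel symbols, and its existence proved separately.
\<close>

definition levi_civita_at :: "('e::euclidean_space \<Rightarrow> 'e \<Rightarrow> 'e \<Rightarrow> real) \<Rightarrow> 'e \<Rightarrow> ('e \<Rightarrow> 'e \<Rightarrow> 'e) \<Rightarrow> bool" where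
  "levi_civita_at G z \<Gamma> \<longleftrightarrow> bilinear \<Gamma> \<and> (\<forall>u v. \<Gamma> u v = \<Gamma> v u) \<and>
     (\<forall>u v w. frechet_derivative (\<lambda>y. G y v w) (at z) u = G z (\<Gamma> u v) w + G z v (\<Gamma> u w))"

lemma koszul:
  assumes "scalar_product (G z)" "levi_civita_at G z \<Gamma>"
  shows "2 * G z (\<Gamma> u v) w =
    frechet_derivative (\<lambda>y. G y v w) (at z) u + frechet_derivative (\<lambda>y. G y u w) (at z) v
    - frechet_derivative (\<lambda>y. G y u v) (at z) w"
proof -
  have "G z a b = G z b a" for a b
    using assms(1) by (simp add: scalar_product_def)
  moreover have "\<Gamma> a b = \<Gamma> b a" for a b
    using assms(2) by (simp add: levi_civita_at_def)
  ultimately have "G z v (\<Gamma> u w) = G z (\<Gamma> w u) v" "G z (\<Gamma> v u) w = G z (\<Gamma> u v) w"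
    "G z u (\<Gamma> v w) = G z u (\<Gamma> w v)"
    by metis+
  then show ?thesis
    using assms(2) by (simp add: levi_civita_at_def)
qed

lemma christoffel_eqI:
  assumes "scalar_product (G z)" "levi_civita_at G z \<Gamma>"
  shows "christoffel G z = \<Gamma>"
proof -
  have "\<Delta> = \<Gamma>" if "levi_civita_at G z \<Delta>" for \<Delta>
  proof (intro ext)
    fix u v
    have "G z (\<Delta> u v) w = G z (\<Gamma> u v) w" for w
      using koszul[OF assms(1) that, of u v w] koszul[OF assms, of u v w] by simp
    then show "\<Delta> u v = \<Gamma> u v"
      by (rule scalar_product_eqI[OF assms(1)])
  qed
  then have "(THE \<Gamma>. levi_civita_at G z \<Gamma>) = \<Gamma>"
    using assms(2) by (intro the_equality)
  then show ?thesis
    by (simp add: christoffel_def levi_civita_at_def)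
qed

text \<open>
  Two derivatives of the components are all that the curvature needs.
\<close>

locale local_metric =
  fixes U :: "'e::euclidean_space set" and G :: "'e \<Rightarrow> 'e \<Rightarrow> 'e \<Rightarrow> real"
  assumes open_U: "open U"
    and scalar_product: "z \<in> U \<Longrightarrow> scalar_product (G z)"
    and differentiable: "z \<in> U \<Longrightarrow> (\<lambda>y. G y v w) differentiable (at z)"
    and differentiable2:
      "z \<in> U \<Longrightarrow> (\<lambda>y. frechet_derivative (\<lambda>x. G x v w) (at y) u) differentiable (at z)"
begin

lemma bilinear: "z \<in> U \<Longrightarrow> bilinear (G z)"
  and sym: "z \<in> U \<Longrightarrow> G z u v = G z v u"
  using scalar_product by (auto simp: scalar_product_def)

abbreviation D :: "'e \<Rightarrow> 'e \<Rightarrow> 'e \<Rightarrow> 'e \<Rightarrow> real" where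
  "D z u v w \<equiv> frechet_derivative (\<lambda>y. G y v w) (at z) u"

lemma linear_D: "z \<in> U \<Longrightarrow> linear (\<lambda>u. D z u v w)"
  using linear_frechet_derivative[OF differentiable] by simp

lemma D_sym:
  assumes "z \<in> U"
  shows "D z u v w = D z u w v"
proof -
  have "frechet_derivative (\<lambda>y. G y v w) (at z) = frechet_derivative (\<lambda>y. G y w v) (at z)"
    using assms sym by (intro frechet_derivative_cong_open[OF open_U])
  then show ?thesis by simp
qed

lemma linear_D2:
  assumes z: "z \<in> U"
  shows "linear (\<lambda>v. D z u v w)"
proof (rule linearI)
  have d: "((\<lambda>y. G y v w) has_derivative (\<lambda>u. D z u v w)) (at z)" for v
    using frechet_derivative_works[THEN iffD1, OF differentiable[OF z]] by simp
  show "D z u (a + b) w = D z u a w + D z u b w" for a b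
  proof -
    have "frechet_derivative (\<lambda>y. G y (a + b) w) (at z)
        = frechet_derivative (\<lambda>y. G y a w + G y b w) (at z)"
      by (intro frechet_derivative_cong_open[OF open_U z]) (simp add: bilinear bilinear_ladd)
    also have "\<dots> = (\<lambda>u. D z u a w + D z u b w)"
      by (rule frechet_derivative_at[symmetric]) (intro has_derivative_add d)
    finally show ?thesis by simp
  qed
  show "D z u (r *\<^sub>R a) w = r *\<^sub>R D z u a w" for r a
  proof -
    have "frechet_derivative (\<lambda>y. G y (r *\<^sub>R a) w) (at z)
        = frechet_derivative (\<lambda>y. r *\<^sub>R G y a w) (at z)"
      by (intro frechet_derivative_cong_open[OF open_U z]) (simp add: bilinear bilinear_lmul)
    also have "\<dots> = (\<lambda>u. r *\<^sub>R D z u a w)"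
      by (rule frechet_derivative_at[symmetric]) (intro has_derivative_scaleR_right d)
    finally show ?thesis by simp
  qed
qed

lemma linear_D3:
  assumes z: "z \<in> U"
  shows "linear (\<lambda>w. D z u v w)"
  using linear_D2[OF z, where u = u and w = v] unfolding D_sym[OF z, where u = u and w = v] .

lemma christoffel: 
  assumes z: "z \<in> U"
  shows "levi_civita_at G z (christoffel G z)"
proof -
  define \<Gamma> where "\<Gamma> u v = sharp (G z) (\<lambda>w. (D z u v w + D z v u w - D z w u v) / 2)" for u v
  note lin = linear_add[OF linear_D] linear_add[OF linear_D2] linear_add[OF linear_D3]
    linear_cmul[OF linear_D] linear_cmul[OF linear_D2] linear_cmul[OF linear_D3]
  have \<Gamma>: "G z (\<Gamma> u v) w = (D z u v w + D z v u w - D z w u v) / 2" for u v w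
    unfolding \<Gamma>_def
  proof (rule sharp[OF scalar_product[OF z]])
    show "linear (\<lambda>w. (D z u v w + D z v u w - D z w u v) / 2)"
      by (rule linearI) (simp_all add: lin z field_simps)
  qed
  have \<Gamma>': "G z w (\<Gamma> u v) = (D z u v w + D z v u w - D z w u v) / 2" for u v w
    using \<Gamma> sym[OF z] by simp
  note Gz = bilinear_ladd[OF bilinear] bilinear_lmul[OF bilinear]
  have lc: "levi_civita_at G z \<Gamma>"
    unfolding levi_civita_at_def
  proof (intro conjI allI)
    show sym\<Gamma>: "\<Gamma> u v = \<Gamma> v u" for u v
    proof (rule scalar_product_eqI[OF scalar_product[OF z]])
      show "G z (\<Gamma> u v) w = G z (\<Gamma> v u) w" for w
        using D_sym[OF z, where u = w and v = u and w = v] by (simp add: \<Gamma>)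
    qed
    have "\<Gamma> (a + b) v = \<Gamma> a v + \<Gamma> b v" "\<Gamma> (r *\<^sub>R a) v = r *\<^sub>R \<Gamma> a v" for a b v r
      by (rule scalar_product_eqI[OF scalar_product[OF z]], simp add: \<Gamma> Gz lin z field_simps)+
    then show "bilinear \<Gamma>"
      unfolding bilinear_def using sym\<Gamma> by (auto intro!: linearI)
    show "D z u v w = G z (\<Gamma> u v) w + G z v (\<Gamma> u w)" for u v w
      using D_sym[OF z] by (simp add: \<Gamma> \<Gamma>' field_simps)
  qed
  show ?thesis
    using lc unfolding christoffel_eqI[OF scalar_product[OF z] lc] .
qed

lemma christoffel_differentiable:
  assumes z: "z \<in> U"
  shows "(\<lambda>y. christoffel G y u v) differentiable (at z)"
proof (rule differentiable_represented[OF open_U z bilinear scalar_product[OF z] differentiable[OF z]])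
  show "(\<lambda>y. (D y u v w + D y v u w - D y w u v) / 2) differentiable (at z)" for w
    using differentiable2[OF z] by (intro derivative_intros) auto
  show "G y (christoffel G y u v) w = (D y u v w + D y v u w - D y w u v) / 2" if "y \<in> U" for y w
    using koszul[OF scalar_product christoffel, of y u v w] that by simp
qed

lemma bilinear_christoffel: "z \<in> U \<Longrightarrow> bilinear (christoffel G z)"
  and christoffel_sym: "z \<in> U \<Longrightarrow> christoffel G z u v = christoffel G z v u"
  using christoffel by (auto simp: levi_civita_at_def)

end

lemma curvature_operator_christoffel:
  assumes "bilinear (christoffel G z)"
  shows "curvature_operator G z u v w =
      frechet_derivative (\<lambda>y. christoffel G y v w) (at z) u
      - frechet_derivative (\<lambda>y. christoffel G y u w) (at z) v
      + christoffel G z u (christoffel G z v w) - christoffel G z v (christoffel G z u w)"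
  using bilinear_lzero[OF assms]
  by (simp add: curvature_operator_def curvature_of_fields_def covariant_derivative_def lie_bracket_def)

section \<open>Curvature of a warped product in product charts\<close>

lemma has_derivative_fst_comp:
  "(k has_derivative k') (at (fst z)) \<Longrightarrow> ((\<lambda>y. k (fst y)) has_derivative (\<lambda>u. k' (fst u))) (at z)"
  by (rule has_derivative_compose[OF has_derivative_fst[OF has_derivative_ident]])

lemma has_derivative_snd_comp:
  "(k has_derivative k') (at (snd z)) \<Longrightarrow> ((\<lambda>y. k (snd y)) has_derivative (\<lambda>u. k' (snd u))) (at z)"
  by (rule has_derivative_compose[OF has_derivative_snd[OF has_derivative_ident]])

lemmas has_frechet_derivative = frechet_derivative_works[THEN iffD1]

locale warped_charts =
  base: local_metric U g + fiber: local_metric V h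
  for U :: "'e::euclidean_space set" and g :: "'e \<Rightarrow> 'e \<Rightarrow> 'e \<Rightarrow> real"
    and V :: "'f::euclidean_space set" and h :: "'f \<Rightarrow> 'f \<Rightarrow> 'f \<Rightarrow> real" +
  fixes f :: "'e \<Rightarrow> real"
  assumes f_pos: "x \<in> U \<Longrightarrow> f x > 0"
    and f_differentiable: "x \<in> U \<Longrightarrow> f differentiable (at x)"
    and f_differentiable2: "x \<in> U \<Longrightarrow> (\<lambda>y. frechet_derivative f (at y) u) differentiable (at x)"
begin

definition G :: "'e \<times> 'f \<Rightarrow> 'e \<times> 'f \<Rightarrow> 'e \<times> 'f \<Rightarrow> real" where
  "G z u v = g (fst z) (fst u) (fst v) + f (fst z) * h (snd z) (snd u) (snd v)"

abbreviation df :: "'e \<Rightarrow> 'e \<Rightarrow> real" where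
  "df x u \<equiv> frechet_derivative f (at x) u"

text \<open>
  Write \<open>f = u\<^sup>2\<close>. The warping enters the connection through the gradient of \<open>f/2\<close>, which is
  \<open>u grad u\<close>, and through the differential of \<open>log u\<close>.
\<close>

definition half_grad :: "'e \<Rightarrow> 'e" where
  "half_grad x = sharp (g x) (\<lambda>w. df x w / 2)"

definition log_sqrt_diff :: "'e \<Rightarrow> 'e \<Rightarrow> real" where
  "log_sqrt_diff x u = df x u / (2 * f x)"

lemma linear_df: "x \<in> U \<Longrightarrow> linear (\<lambda>u. df x u)"
  using linear_frechet_derivative[OF f_differentiable] by simp

lemma linear_log_sqrt_diff: "x \<in> U \<Longrightarrow> linear (\<lambda>u. log_sqrt_diff x u)"
  using linear_df[of x] by (simp add: linear_iff log_sqrt_diff_def add_divide_distrib)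

lemma half_grad:
  assumes x: "x \<in> U"
  shows "g x (half_grad x) w = df x w / 2"
  unfolding half_grad_def
  using linear_df[OF x]
  by (intro sharp[OF base.scalar_product[OF x]]) (simp add: linear_iff add_divide_distrib)

lemma half_grad_differentiable:
  assumes x: "x \<in> U"
  shows "half_grad differentiable (at x)"
proof (rule differentiable_represented[OF base.open_U x base.bilinear base.scalar_product[OF x]
      base.differentiable[OF x] _ half_grad])
  show "(\<lambda>y. df y w / 2) differentiable (at x)" for w
    using f_differentiable2[OF x] by (intro derivative_intros) auto
qed

lemma log_sqrt_diff_differentiable:
  assumes x: "x \<in> U"
  shows "(\<lambda>y. log_sqrt_diff y u) differentiable (at x)"
  unfolding log_sqrt_diff_def using f_pos[OF x] f_differentiable[OF x] f_differentiable2[OF x]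
  by (intro derivative_intros) auto

lemma open_UV: "open (U \<times> V)"
  by (intro open_Times base.open_U fiber.open_U)

lemma scalar_product_G:
  assumes z: "z \<in> U \<times> V"
  shows "scalar_product (G z)"
proof -
  obtain x y where z: "z = (x, y)" "x \<in> U" "y \<in> V"
    using assms by auto
  note bil = base.bilinear[OF z(2)] fiber.bilinear[OF z(3)]
  have "bilinear (G z)"
    unfolding bilinear_def G_def
    by (auto intro!: linearI
        simp: z bil[THEN bilinear_ladd] bil[THEN bilinear_lmul] bil[THEN bilinear_radd] bil[THEN bilinear_rmul] algebra_simps)
  moreover have "G z u v = G z v u" for u v
    using base.sym[OF z(2)] fiber.sym[OF z(3)] by (simp add: G_def z)
  moreover have "u = 0" if u: "\<forall>v. G z u v = 0" for u
  proof -
    have "g x (fst u) a = g x 0 a" for a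
      using u[THEN spec, of "(a, 0)"]
      by (simp add: G_def z bil[THEN bilinear_lzero] bil[THEN bilinear_rzero])
    moreover have "h y (snd u) a = h y 0 a" for a
      using u[THEN spec, of "(0, a)"] f_pos[OF z(2)]
      by (simp add: G_def z bil[THEN bilinear_lzero] bil[THEN bilinear_rzero])
    ultimately show "u = 0"
      using scalar_product_eqI[OF base.scalar_product[OF z(2)]]
        scalar_product_eqI[OF fiber.scalar_product[OF z(3)]]
      by (metis prod.collapse zero_prod_def)
  qed
  ultimately show ?thesis
    by (simp add: scalar_product_def)
qed

lemma G_derivative:
  assumes x: "x \<in> U" and y: "y \<in> V"
  shows "frechet_derivative (\<lambda>z. G z v w) (at (x, y)) u =
    base.D x (fst u) (fst v) (fst w) + f x * fiber.D y (snd u) (snd v) (snd w)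
    + df x (fst u) * h y (snd v) (snd w)"
proof -
  have "((\<lambda>z. g (fst z) (fst v) (fst w) + f (fst z) * h (snd z) (snd v) (snd w)) has_derivative
     (\<lambda>u. base.D x (fst u) (fst v) (fst w) + (f (fst (x, y)) * fiber.D y (snd u) (snd v) (snd w)
    + df x (fst u) * h (snd (x, y)) (snd v) (snd w)))) (at (x, y))"
    by (intro has_derivative_add has_derivative_mult
        has_derivative_fst_comp[where k = "\<lambda>x. g x (fst v) (fst w)"]
        has_derivative_fst_comp[where k = f]
        has_derivative_snd_comp[where k = "\<lambda>x. h x (snd v) (snd w)"])
      (simp_all add: has_frechet_derivative base.differentiable[OF x] fiber.differentiable[OF y]
        f_differentiable[OF x])
  from frechet_derivative_at[OF this, symmetric] show ?thesis
    by (simp add: G_def)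
qed

text \<open>
  O'Neill's formulas: base and fiber keep their own connections; fiber fields acquire the normal
  component \<open>-h half_grad\<close>, and mixed derivatives only rescale the fiber vector. By uniqueness of the
  Levi-Civita connection it is enough to check that these formulas are symmetric and metric.
\<close>

lemma christoffel_G:
  assumes x: "x \<in> U" and y: "y \<in> V"
  shows "christoffel G (x, y) = (\<lambda>u v.
    (christoffel g x (fst u) (fst v) - h y (snd u) (snd v) *\<^sub>R half_grad x,
     christoffel h y (snd u) (snd v) + log_sqrt_diff x (fst u) *\<^sub>R snd v + log_sqrt_diff x (fst v) *\<^sub>R snd u))"
    (is "_ = ?\<Gamma>")
proof (rule christoffel_eqI)
  show "scalar_product (G (x, y))"
    using x y by (intro scalar_product_G) simp
  have lcg: "levi_civita_at g x (christoffel g x)"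
    using base.christoffel[OF x] .
  have lch: "levi_civita_at h y (christoffel h y)"
    using fiber.christoffel[OF y] .
  have bilg: "bilinear (g x)" and bilh: "bilinear (h y)"
    using base.bilinear[OF x] fiber.bilinear[OF y] .
  note bil = bilg bilh base.bilinear_christoffel[OF x] fiber.bilinear_christoffel[OF y]
  note bils = bil[THEN bilinear_ladd] bil[THEN bilinear_lmul] bil[THEN bilinear_radd]
    bil[THEN bilinear_rmul] linear_add[OF linear_log_sqrt_diff[OF x]] linear_cmul[OF linear_log_sqrt_diff[OF x]]
  show "levi_civita_at G (x, y) ?\<Gamma>"
    unfolding levi_civita_at_def
  proof (intro conjI allI)
    show "bilinear ?\<Gamma>"
      unfolding bilinear_def
      by (auto intro!: linearI simp: bils algebra_simps)
    show "?\<Gamma> u v = ?\<Gamma> v u" for u v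
      using base.christoffel_sym[OF x] fiber.christoffel_sym[OF y] fiber.sym[OF y] by simp
    fix u v w :: "'e \<times> 'f"
    have g0: "base.D x (fst u) (fst v) (fst w)
       = g x (christoffel g x (fst u) (fst v)) (fst w) + g x (fst v) (christoffel g x (fst u) (fst w))"
      using lcg by (simp add: levi_civita_at_def)
    have h0: "fiber.D y (snd u) (snd v) (snd w)
       = h y (christoffel h y (snd u) (snd v)) (snd w) + h y (snd v) (christoffel h y (snd u) (snd w))"
      using lch by (simp add: levi_civita_at_def)
    have N: "g x (half_grad x) a = df x a / 2" "g x a (half_grad x) = df x a / 2" for a
      using half_grad[OF x] base.sym[OF x] by auto
    have L: "df x a = 2 * f x * log_sqrt_diff x a" for a
      using f_pos[OF x] by (simp add: log_sqrt_diff_def)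
    show "frechet_derivative (\<lambda>z. G z v w) (at (x, y)) u =
        G (x, y) (?\<Gamma> u v) w + G (x, y) v (?\<Gamma> u w)"
      unfolding G_derivative[OF x y] g0 h0
      using fiber.sym[OF y, of "snd v" "snd u"] fiber.sym[OF y, of "snd w" "snd u"] fiber.sym[OF y, of "snd w" "snd v"]
      by (simp add: G_def bils bilinear_lsub[OF bilg] bilinear_rsub[OF bilg] N L algebra_simps)
  qed
qed

lemma christoffel_G_derivative:
  assumes x: "x \<in> U" and y: "y \<in> V"
  shows "frechet_derivative (\<lambda>z. christoffel G z v w) (at (x, y)) u =
    (frechet_derivative (\<lambda>x. christoffel g x (fst v) (fst w)) (at x) (fst u)
       - (h y (snd v) (snd w) *\<^sub>R frechet_derivative half_grad (at x) (fst u)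
          + fiber.D y (snd u) (snd v) (snd w) *\<^sub>R half_grad x),
     frechet_derivative (\<lambda>y. christoffel h y (snd v) (snd w)) (at y) (snd u)
       + frechet_derivative (\<lambda>x. log_sqrt_diff x (fst v)) (at x) (fst u) *\<^sub>R snd w
       + frechet_derivative (\<lambda>x. log_sqrt_diff x (fst w)) (at x) (fst u) *\<^sub>R snd v)"
proof -
  have "((\<lambda>z. (christoffel g (fst z) (fst v) (fst w) - h (snd z) (snd v) (snd w) *\<^sub>R half_grad (fst z),
     christoffel h (snd z) (snd v) (snd w) + log_sqrt_diff (fst z) (fst v) *\<^sub>R snd w
       + log_sqrt_diff (fst z) (fst w) *\<^sub>R snd v)) has_derivative
     (\<lambda>u. (frechet_derivative (\<lambda>x. christoffel g x (fst v) (fst w)) (at x) (fst u)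
       - (h (snd (x, y)) (snd v) (snd w) *\<^sub>R frechet_derivative half_grad (at x) (fst u)
          + fiber.D y (snd u) (snd v) (snd w) *\<^sub>R half_grad (fst (x, y))),
     frechet_derivative (\<lambda>y. christoffel h y (snd v) (snd w)) (at y) (snd u)
       + frechet_derivative (\<lambda>x. log_sqrt_diff x (fst v)) (at x) (fst u) *\<^sub>R snd w
       + frechet_derivative (\<lambda>x. log_sqrt_diff x (fst w)) (at x) (fst u) *\<^sub>R snd v))) (at (x, y))"
    by (intro has_derivative_Pair has_derivative_add has_derivative_diff has_derivative_scaleR
        has_derivative_scaleR_left
        has_derivative_fst_comp[where k = "\<lambda>x. christoffel g x (fst v) (fst w)"]
        has_derivative_fst_comp[where k = half_grad]
        has_derivative_fst_comp[where k = "\<lambda>x. log_sqrt_diff x a" for a]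
        has_derivative_snd_comp[where k = "\<lambda>x. h x (snd v) (snd w)"]
        has_derivative_snd_comp[where k = "\<lambda>x. christoffel h x (snd v) (snd w)"])
      (simp_all add: has_frechet_derivative base.christoffel_differentiable[OF x]
        fiber.christoffel_differentiable[OF y] half_grad_differentiable[OF x]
        log_sqrt_diff_differentiable[OF x] fiber.differentiable[OF y])
  then have "((\<lambda>z. christoffel G z v w) has_derivative
     (\<lambda>u. (frechet_derivative (\<lambda>x. christoffel g x (fst v) (fst w)) (at x) (fst u)
       - (h (snd (x, y)) (snd v) (snd w) *\<^sub>R frechet_derivative half_grad (at x) (fst u)
          + fiber.D y (snd u) (snd v) (snd w) *\<^sub>R half_grad (fst (x, y))),
     frechet_derivative (\<lambda>y. christoffel h y (snd v) (snd w)) (at y) (snd u)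
       + frechet_derivative (\<lambda>x. log_sqrt_diff x (fst v)) (at x) (fst u) *\<^sub>R snd w
       + frechet_derivative (\<lambda>x. log_sqrt_diff x (fst w)) (at x) (fst u) *\<^sub>R snd v))) (at (x, y))"
    by (rule has_derivative_transform_within_open[OF _ open_UV]) (use x y in \<open>auto simp: christoffel_G\<close>)
  from frechet_derivative_at[OF this, symmetric] show ?thesis
    by simp
qed

context
  fixes x y
  assumes x: "x \<in> U" and y: "y \<in> V"
begin

private lemmas bil = base.bilinear[OF x] fiber.bilinear[OF y]
  base.bilinear_christoffel[OF x] fiber.bilinear_christoffel[OF y]

lemma bilinear_christoffel_G: "bilinear (christoffel G (x, y))"
  unfolding christoffel_G[OF x y] bilinear_def
  by (auto intro!: linearI simp: bil[THEN bilinear_ladd] bil[THEN bilinear_lmul]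
      bil[THEN bilinear_radd] bil[THEN bilinear_rmul] linear_add[OF linear_log_sqrt_diff[OF x]]
      linear_cmul[OF linear_log_sqrt_diff[OF x]] algebra_simps)

private lemmas linear_derivs =
  linear_frechet_derivative[OF base.christoffel_differentiable[OF x]]
  linear_frechet_derivative[OF fiber.christoffel_differentiable[OF y]]
  linear_frechet_derivative[OF half_grad_differentiable[OF x]]
  linear_frechet_derivative[OF log_sqrt_diff_differentiable[OF x]]
  linear_frechet_derivative[OF fiber.differentiable[OF y]]

text \<open>
  The curvature is evaluated on vectors tangent to one of the factors, so one component of each
  argument is zero. The Christoffel symbols then vanish identically in the point, and so do their
  derivatives.
\<close>

private lemma zeros:
  "frechet_derivative (\<lambda>x. christoffel g x 0 b) (at x) = (\<lambda>_. 0)"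
  "frechet_derivative (\<lambda>x. christoffel g x b 0) (at x) = (\<lambda>_. 0)"
  "frechet_derivative (\<lambda>y. christoffel h y 0 c) (at y) = (\<lambda>_. 0)"
  "frechet_derivative (\<lambda>y. christoffel h y c 0) (at y) = (\<lambda>_. 0)"
  "frechet_derivative (\<lambda>x. log_sqrt_diff x 0) (at x) = (\<lambda>_. 0)"
  "frechet_derivative (\<lambda>y. h y 0 c) (at y) = (\<lambda>_. 0)"
  "frechet_derivative (\<lambda>y. h y c 0) (at y) = (\<lambda>_. 0)"
  by (subst frechet_derivative_cong_open[OF base.open_U x, where g = "\<lambda>_. 0"]
      frechet_derivative_cong_open[OF fiber.open_U y, where g = "\<lambda>_. 0"],
      simp_all add: bilinear_lzero bilinear_rzero base.bilinear_christoffel fiber.bilinear_christoffel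
        fiber.bilinear linear_0[OF linear_log_sqrt_diff])+

private lemmas curvature_simps =
  curvature_operator_christoffel[OF bilinear_christoffel_G]
  curvature_operator_christoffel[OF base.bilinear_christoffel[OF x]]
  curvature_operator_christoffel[OF fiber.bilinear_christoffel[OF y]]
  christoffel_G_derivative[OF x y] christoffel_G[OF x y] 
  bil[THEN bilinear_ladd] bil[THEN bilinear_lmul] bil[THEN bilinear_lsub] bil[THEN bilinear_lneg] bil[THEN bilinear_lzero]
  bil[THEN bilinear_radd] bil[THEN bilinear_rmul] bil[THEN bilinear_rsub] bil[THEN bilinear_rneg] bil[THEN bilinear_rzero]
  linear_derivs[THEN linear_0] zeros linear_0[OF linear_log_sqrt_diff[OF x]]
  linear_cmul[OF linear_log_sqrt_diff[OF x]] linear_neg[OF linear_log_sqrt_diff[OF x]]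

abbreviation R where "R \<equiv> curvature_operator G (x, y)"

lemma R_fiber_fiber_base: "R (0, \<alpha>) (0, \<beta>) (c, 0) = 0"
  using fiber.sym[OF y, of \<alpha> \<beta>] fiber.christoffel_sym[OF y, of \<alpha> \<beta>]
  by (simp add: curvature_simps)

lemma fst_R_base_base: "fst (R u (b, 0) (c, 0)) = curvature_operator g x (fst u) b c"
  by (simp add: curvature_simps)

text \<open>With \<open>f = u\<^sup>2\<close> this is \<open>-Hess u (b, c) / u\<close>, by the product rule for \<open>Hess (log u)\<close>.\<close>

definition hessian_term where
  "hessian_term b c = log_sqrt_diff x (christoffel g x b c)
     - frechet_derivative (\<lambda>x. log_sqrt_diff x c) (at x) b - log_sqrt_diff x b * log_sqrt_diff x c"

lemma R_fiber_base_base: "R (0, \<alpha>) (b, 0) (c, 0) = (0, hessian_term b c *\<^sub>R \<alpha>)"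
  by (simp add: curvature_simps hessian_term_def algebra_simps)

text \<open>With \<open>f = u\<^sup>2\<close> this is \<open>-u \<nabla>\<^sub>a grad u\<close>.\<close>

definition hessian_operator where
  "hessian_operator a = log_sqrt_diff x a *\<^sub>R half_grad x - frechet_derivative half_grad (at x) a
     - christoffel g x a (half_grad x)"

lemma fst_R_base_fiber_fiber: "fst (R (a, 0) (0, \<beta>) (0, \<gamma>)) = h y \<beta> \<gamma> *\<^sub>R hessian_operator a"
  by (simp add: curvature_simps hessian_operator_def algebra_simps)

text \<open>
  The Gauss equation: the fiber through \<open>(x, y)\<close> is totally umbilic, so its second fundamental form
  contributes only products of \<open>h\<close> with itself.
\<close>

lemma snd_R_fiber_fiber_fiber:
  "snd (R (0, \<gamma>) (0, \<beta>) (0, \<alpha>)) = curvature_operator h y \<gamma> \<beta> \<alpha>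
     - log_sqrt_diff x (half_grad x) *\<^sub>R (h y \<beta> \<alpha> *\<^sub>R \<gamma> - h y \<gamma> \<alpha> *\<^sub>R \<beta>)"
  by (simp add: curvature_simps algebra_simps)

end

end

section \<open>The curvature condition in product charts\<close>

lemma curvature_operator_antisym:
  assumes "bilinear (christoffel G z)"
  shows "curvature_operator G z u v w = - curvature_operator G z v u w"
  by (simp add: curvature_operator_christoffel[OF assms])

lemma (in local_metric) curvature_operator_scaleR:
  assumes z: "z \<in> U"
  shows "curvature_operator G z (r *\<^sub>R u) v w = r *\<^sub>R curvature_operator G z u v w"
proof -
  have d: "((\<lambda>y. christoffel G y u w) has_derivative
      (\<lambda>v. frechet_derivative (\<lambda>y. christoffel G y u w) (at z) v)) (at z)"
    using frechet_derivative_works[THEN iffD1, OF christoffel_differentiable[OF z]] by simp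
  have "frechet_derivative (\<lambda>y. christoffel G y (r *\<^sub>R u) w) (at z)
      = frechet_derivative (\<lambda>y. r *\<^sub>R christoffel G y u w) (at z)"
    by (intro frechet_derivative_cong_open[OF open_U z]) (simp add: bilinear_christoffel bilinear_lmul)
  also have "\<dots> = (\<lambda>v. r *\<^sub>R frechet_derivative (\<lambda>y. christoffel G y u w) (at z) v)"
    by (rule frechet_derivative_at[symmetric]) (intro has_derivative_scaleR_right d)
  finally show ?thesis
    using bilinear_christoffel[OF z] linear_frechet_derivative[OF christoffel_differentiable[OF z]]
    by (simp add: curvature_operator_christoffel bilinear_lmul bilinear_rmul linear_cmul algebra_simps)
qed

lemma sum_Basis_prod:
  "(\<Sum>z\<in>Basis. k z) = (\<Sum>a\<in>Basis. k (a, 0)) + (\<Sum>b\<in>Basis. k (0, b))"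
  for k :: "'a::euclidean_space \<times> 'b::euclidean_space \<Rightarrow> 'c::comm_monoid_add"
  unfolding Basis_prod_def
  by (subst sum.union_disjoint) (auto simp: sum.reindex inj_on_def)

context warped_charts
begin

context
  fixes x y
  assumes x: "x \<in> U" and y: "y \<in> V"
begin

text \<open>
  On fiber vectors the Ricci tensor of the warped product differs from that of the fiber only by a
  multiple of \<open>h\<close>: this is what the warping contributes to the trace.
\<close>

lemma ricci_fiber:
  "(\<Sum>e\<in>Basis. R x y e (0, \<beta>) (0, \<alpha>) \<bullet> e) =
     (\<Sum>e\<in>Basis. curvature_operator h y e \<beta> \<alpha> \<bullet> e)
     + h y \<beta> \<alpha> * ((\<Sum>e\<in>Basis. hessian_operator x e \<bullet> e)
          - log_sqrt_diff x (half_grad x) * (real DIM('f) - 1))"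
proof -
  have "(\<Sum>e\<in>Basis. R x y (e, 0) (0, \<beta>) (0, \<alpha>) \<bullet> (e, 0))
      = h y \<beta> \<alpha> * (\<Sum>e\<in>Basis. hessian_operator x e \<bullet> e)"
    by (simp add: inner_prod_def fst_R_base_fiber_fiber[OF x y] sum_distrib_left)
  moreover have "(\<Sum>e\<in>Basis. R x y (0, e) (0, \<beta>) (0, \<alpha>) \<bullet> (0, e))
      = (\<Sum>e\<in>Basis. curvature_operator h y e \<beta> \<alpha> \<bullet> e)
        - log_sqrt_diff x (half_grad x) * (\<Sum>e\<in>Basis. (h y \<beta> \<alpha> *\<^sub>R e - h y e \<alpha> *\<^sub>R \<beta>) \<bullet> e)"
    by (simp add: inner_prod_def snd_R_fiber_fiber_fiber[OF x y] inner_diff_left sum_subtractf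
        right_diff_distrib sum_distrib_left)
  moreover have "(\<Sum>e\<in>Basis. (h y \<beta> \<alpha> *\<^sub>R e - h y e \<alpha> *\<^sub>R \<beta>) \<bullet> e)
      = h y \<beta> \<alpha> * (real DIM('f) - 1)"
  proof -
    have "(\<Sum>e\<in>Basis. (h y \<beta> \<alpha> *\<^sub>R e - h y e \<alpha> *\<^sub>R \<beta>) \<bullet> e)
        = h y \<beta> \<alpha> * real DIM('f) - (\<Sum>e\<in>Basis. (\<beta> \<bullet> e) *\<^sub>R h y e \<alpha>)"
      by (simp add: inner_diff_left sum_subtractf mult.commute)
    also have "(\<Sum>e\<in>Basis. (\<beta> \<bullet> e) *\<^sub>R h y e \<alpha>) = h y \<beta> \<alpha>"
      by (rule bilinear_Basis_expand[OF fiber.bilinear[OF y], symmetric])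
    finally show ?thesis by (simp add: algebra_simps)
  qed
  ultimately show ?thesis
    by (simp only: sum_Basis_prod) (simp only: algebra_simps)
qed

lemma R_base_fiber_base: "R x y (a, 0) (0, \<beta>) (c, 0) = (0, - hessian_term x a c *\<^sub>R \<beta>)"
  using curvature_operator_antisym[OF bilinear_christoffel_G[OF x y], of "(a, 0)" "(0, \<beta>)" "(c, 0)"]
  by (simp add: R_fiber_base_base[OF x y])

lemma fst_R_fiber_base_fiber:
  "fst (R x y (0, \<alpha>) (b, 0) (0, \<gamma>)) = - (h y \<alpha> \<gamma> *\<^sub>R hessian_operator x b)"
  using curvature_operator_antisym[OF bilinear_christoffel_G[OF x y], of "(0, \<alpha>)" "(b, 0)" "(0, \<gamma>)"]
  by (simp add: fst_R_base_fiber_fiber[OF x y])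

text \<open>
  The condition is evaluated on \<open>(\<alpha>, b, c, d; a, \<beta>)\<close> with \<open>\<alpha>\<close>, \<open>\<beta>\<close> tangent to
  the fiber and \<open>a\<close>, \<open>b\<close>, \<open>c\<close>, \<open>d\<close> tangent to the base. Components of \<open>R\<close> with exactly one fiber
  argument vanish, and so do those of the form \<open>R(\<alpha>, \<beta>, c, d)\<close>; all other components with two fiber
  arguments are multiples of \<open>h(\<alpha>, \<beta>)\<close>. Hence in \<open>Q(S, R)\<close> the term \<open>S(\<beta>, \<alpha>) R(a, b, c, d)\<close> is the
  only one that is not visibly a multiple of \<open>h(\<beta>, \<alpha>)\<close>.
\<close>

lemma ricci_fiber_times_base_curvature:
  fixes S :: "'e \<times> 'f \<Rightarrow> 'e \<times> 'f \<Rightarrow> real"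
  assumes "\<And>Xs X Y. length Xs = 4 \<Longrightarrow>
     derivation_tensor (R x y) (tensor4 (\<lambda>u v w t. G (x, y) (R x y u v w) t)) Xs X Y =
     tachibana_tensor S (tensor4 (\<lambda>u v w t. G (x, y) (R x y u v w) t)) Xs X Y"
  shows "S (0, \<beta>) (0, \<alpha>) * g x (curvature_operator g x a b c) d =
    h y \<beta> \<alpha> * (g x (curvature_operator g x (hessian_operator x a) b c) d
      + (hessian_term x a c - S (a, 0) (c, 0)) * g x (hessian_operator x b) d
      + f x * hessian_term x b c * (S (a, 0) (d, 0) - hessian_term x a d))"
  using assms[of "[(0, \<alpha>), (b, 0), (c, 0), (d, 0)]" "(a, 0)" "(0, \<beta>)"]
    base.bilinear[OF x] fiber.bilinear[OF y] fiber.sym[OF y, of \<alpha> \<beta>]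
  by (simp add: derivation_tensor_def tachibana_tensor_def tensor4_def G_def eval_nat_numeral
      fst_R_base_base[OF x y] R_base_fiber_base R_fiber_base_base[OF x y]
      R_fiber_fiber_base[OF x y] fst_R_fiber_base_fiber fst_R_base_fiber_fiber[OF x y]
      base.curvature_operator_scaleR[OF x] bilinear_lzero bilinear_rzero bilinear_lmul bilinear_rmul
      bilinear_lneg bilinear_rneg algebra_simps)

lemma fiber_ricci_proportional:
  assumes RR: "\<And>Xs X Y. length Xs = 4 \<Longrightarrow>
     derivation_tensor (R x y) (tensor4 (\<lambda>u v w t. G (x, y) (R x y u v w) t)) Xs X Y =
     tachibana_tensor (\<lambda>v w. \<Sum>e\<in>Basis. R x y e v w \<bullet> e)
       (tensor4 (\<lambda>u v w t. G (x, y) (R x y u v w) t)) Xs X Y"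
    and nonflat: "g x (curvature_operator g x a b c) d \<noteq> 0"
  shows "\<exists>l. \<forall>\<beta> \<alpha>. (\<Sum>e\<in>Basis. curvature_operator h y e \<beta> \<alpha> \<bullet> e) = l * h y \<beta> \<alpha>"
proof -
  obtain K where "(\<Sum>e\<in>Basis. R x y e (0, \<beta>) (0, \<alpha>) \<bullet> e) * g x (curvature_operator g x a b c) d
      = h y \<beta> \<alpha> * K" for \<beta> \<alpha>
    using ricci_fiber_times_base_curvature[OF RR] by blast
  then have "(\<Sum>e\<in>Basis. curvature_operator h y e \<beta> \<alpha> \<bullet> e) =
     (K / g x (curvature_operator g x a b c) d - ((\<Sum>e\<in>Basis. hessian_operator x e \<bullet> e)
          - log_sqrt_diff x (half_grad x) * (real DIM('f) - 1))) * h y \<beta> \<alpha>" for \<beta> \<alpha>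
    unfolding ricci_fiber using nonflat by (simp add: field_simps)
  then show ?thesis by blast
qed

end

end

section \<open>From manifolds to charts\<close>

lemma smooth_manifold_chart:
  assumes M: "smooth_manifold M" and i: "i \<in> charts M"
  shows "inj_on (chart_map M i) (chart_dom M i)"
    and "open (chart_img M i)"
    and "p \<in> chart_dom M i \<Longrightarrow> chart_inv M i (chart_map M i p) = p"
    and "z \<in> chart_img M i \<Longrightarrow> chart_inv M i z \<in> chart_dom M i"
    and "z \<in> chart_img M i \<Longrightarrow> chart_map M i (chart_inv M i z) = z"
    and "p \<in> chart_dom M i \<Longrightarrow> chart_map M i p \<in> chart_img M i"
proof -
  have "chart_dom M i \<subseteq> topspace (man_top M)"
    using M i openin_subset unfolding smooth_manifold_def by blast
  moreover have "homeomorphic_map (subtopology (man_top M) (chart_dom M i))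
          (top_of_set (chart_img M i)) (chart_map M i)"
    using M i unfolding smooth_manifold_def by blast
  ultimately show inj: "inj_on (chart_map M i) (chart_dom M i)"
    using homeomorphic_imp_injective_map by (fastforce simp: topspace_subtopology Int_absorb1)
  show "open (chart_img M i)"
    using M i by (simp add: smooth_manifold_def)
  show "p \<in> chart_dom M i \<Longrightarrow> chart_inv M i (chart_map M i p) = p"
    using inj by (simp add: chart_inv_def)
  show "z \<in> chart_img M i \<Longrightarrow> chart_inv M i z \<in> chart_dom M i"
    by (simp add: chart_inv_def chart_img_def inv_into_into)
  show "z \<in> chart_img M i \<Longrightarrow> chart_map M i (chart_inv M i z) = z"
    by (simp add: chart_inv_def chart_img_def f_inv_into_f)
  show "p \<in> chart_dom M i \<Longrightarrow> chart_map M i p \<in> chart_img M i"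
    by (simp add: chart_img_def)
qed

lemma smooth_on_differentiable:
  assumes "smooth_on U k" "z \<in> U"
  shows "k differentiable (at z)"
    and "(\<lambda>y. frechet_derivative k (at y) u) differentiable (at z)"
proof -
  have "Ck (Suc (Suc 0)) U k"
    using assms(1) by (simp only: smooth_on_def)
  then show "k differentiable (at z)"
    "(\<lambda>y. frechet_derivative k (at y) u) differentiable (at z)"
    using assms(2) by simp_all
qed

lemma metric_scalar_product:
  assumes "semi_riemannian_manifold M g" "i \<in> charts M" "p \<in> chart_dom M i"
  shows "scalar_product (g i p)"
  using assms unfolding semi_riemannian_manifold_def semi_riemannian_metric_def scalar_product_def
  by blast

lemma local_metric_chart:
  assumes M: "semi_riemannian_manifold M g" and i: "i \<in> charts M"
  shows "local_metric (chart_img M i) (\<lambda>z. g i (chart_inv M i z))"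
proof -
  have m: "smooth_manifold M" "semi_riemannian_metric M g"
    using M by (auto simp: semi_riemannian_manifold_def)
  have "smooth_on (chart_img M i) (\<lambda>z. g i (chart_inv M i z) u v)" for u v
    using m(2) i unfolding semi_riemannian_metric_def by blast
  from smooth_on_differentiable[OF this] show ?thesis
    by unfold_locales
      (use metric_scalar_product[OF M i] smooth_manifold_chart[OF m(1) i] in auto)
qed

lemma curvature_operator_cong_open:
  assumes "open W" "z \<in> W" "\<And>y. y \<in> W \<Longrightarrow> G y = H y"
  shows "curvature_operator G z = curvature_operator H z"
proof -
  have eq: "christoffel G y = christoffel H y" if "y \<in> W" for y
    using assms that by (intro christoffel_cong_open)
  have "frechet_derivative (\<lambda>y. christoffel G y v w) (at z)
      = frechet_derivative (\<lambda>y. christoffel H y v w) (at z)" for v w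
    using assms(1,2) by (rule frechet_derivative_cong_open) (simp add: eq)
  then show ?thesis
    by (intro ext) (simp add: curvature_operator_def curvature_of_fields_def
        covariant_derivative_def lie_bracket_def eq[OF assms(2)])
qed

lemma product_chart_inv:
  assumes "smooth_manifold B" "smooth_manifold F" "i \<in> charts B" "j \<in> charts F"
    and "x \<in> chart_img B i" "y \<in> chart_img F j"
  shows "chart_inv (product_manifold B F) (i, j) (x, y) = (chart_inv B i x, chart_inv F j y)"
proof -
  note B = smooth_manifold_chart[OF assms(1,3)] and F = smooth_manifold_chart[OF assms(2,4)]
  have "inj_on (map_prod (chart_map B i) (chart_map F j)) (chart_dom B i \<times> chart_dom F j)"
    using B(1) F(1) by (rule map_prod_inj_on)
  then show ?thesis
    unfolding chart_inv_def[of "product_manifold B F"]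
    by (intro inv_into_f_eq)
      (use assms(5,6) B F in \<open>auto simp: product_manifold_def\<close>)
qed

lemma transition_differentiable:
  assumes M: "smooth_manifold M" and i: "i \<in> charts M" and k: "k \<in> charts M"
    and p: "p \<in> chart_dom M i" "p \<in> chart_dom M k"
  shows "(chart_map M k \<circ> chart_inv M i) differentiable (at (chart_map M i p))"
proof -
  have "smooth_on (chart_map M i ` (chart_dom M i \<inter> chart_dom M k)) (chart_map M k \<circ> chart_inv M i)"
    using M i k unfolding smooth_manifold_def by blast
  then show ?thesis
    using p by (intro smooth_on_differentiable(1)) auto
qed

lemma local_differential_projections:
  assumes B: "smooth_manifold B" and F: "smooth_manifold F"
    and i: "i \<in> charts B" and j: "j \<in> charts F"
    and p: "p \<in> chart_dom B i" and q: "q \<in> chart_dom F j"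
  shows "k \<in> charts B \<Longrightarrow> p \<in> chart_dom B k \<Longrightarrow>
      local_differential (product_manifold B F) B fst (i, j) k (p, q) u
      = local_differential B B id i k p (fst u)"
    and "l \<in> charts F \<Longrightarrow> q \<in> chart_dom F l \<Longrightarrow>
      local_differential (product_manifold B F) F snd (i, j) l (p, q) u
      = local_differential F F id j l q (snd u)"
proof -
  have op: "open (chart_img B i \<times> chart_img F j)"
    "(chart_map B i p, chart_map F j q) \<in> chart_img B i \<times> chart_img F j"
    using smooth_manifold_chart[OF B i] smooth_manifold_chart[OF F j] p q by (auto intro: open_Times)
  have pt: "chart_map (product_manifold B F) (i, j) (p, q) = (chart_map B i p, chart_map F j q)"
    by (simp add: product_manifold_def)
  {
    assume k: "k \<in> charts B" "p \<in> chart_dom B k"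
    have "frechet_derivative (chart_map B k \<circ> fst \<circ> chart_inv (product_manifold B F) (i, j))
        (at (chart_map B i p, chart_map F j q))
      = frechet_derivative (\<lambda>z. (chart_map B k \<circ> chart_inv B i) (fst z))
        (at (chart_map B i p, chart_map F j q))"
      by (rule frechet_derivative_cong_open[OF op]) (auto simp: product_chart_inv[OF B F i j])
    also have "\<dots> = (\<lambda>u. frechet_derivative (chart_map B k \<circ> chart_inv B i) (at (chart_map B i p)) (fst u))"
      using transition_differentiable[OF B i k(1) p k(2)]
      by (intro frechet_derivative_at[symmetric] has_derivative_fst_comp)
        (simp only: frechet_derivative_works fst_conv snd_conv)
    finally show "local_differential (product_manifold B F) B fst (i, j) k (p, q) u
      = local_differential B B id i k p (fst u)"
      by (simp add: local_differential_def pt)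
  next
    assume l: "l \<in> charts F" "q \<in> chart_dom F l"
    have "frechet_derivative (chart_map F l \<circ> snd \<circ> chart_inv (product_manifold B F) (i, j))
        (at (chart_map B i p, chart_map F j q))
      = frechet_derivative (\<lambda>z. (chart_map F l \<circ> chart_inv F j) (snd z))
        (at (chart_map B i p, chart_map F j q))"
      by (rule frechet_derivative_cong_open[OF op]) (auto simp: product_chart_inv[OF B F i j])
    also have "\<dots> = (\<lambda>u. frechet_derivative (chart_map F l \<circ> chart_inv F j) (at (chart_map F j q)) (snd u))"
      using transition_differentiable[OF F j l(1) q l(2)]
      by (intro frechet_derivative_at[symmetric] has_derivative_snd_comp)
        (simp only: frechet_derivative_works fst_conv snd_conv)
    finally show "local_differential (product_manifold B F) F snd (i, j) l (p, q) u
      = local_differential F F id j l q (snd u)"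
      by (simp add: local_differential_def pt)
  }
qed

text \<open>
  The pullbacks of the definition use arbitrarily chosen charts around the projected points; the
  transformation law of the two metrics moves them to the charts \<open>i\<close> and \<open>j\<close>.
\<close>

lemma warped_metric_product_chart:
  assumes B: "semi_riemannian_manifold B gB" and F: "semi_riemannian_manifold F gF"
    and i: "i \<in> charts B" and j: "j \<in> charts F"
    and p: "p \<in> chart_dom B i" and q: "q \<in> chart_dom F j"
  shows "warped_metric B F gB gF f (i, j) (p, q) u v
    = gB i p (fst u) (fst v) + f p * gF j q (snd u) (snd v)"
proof -
  have m: "smooth_manifold B" "smooth_manifold F"
      "semi_riemannian_metric B gB" "semi_riemannian_metric F gF"
    using B F by (auto simp: semi_riemannian_manifold_def)
  define k where "k = (SOME k. k \<in> charts B \<and> p \<in> chart_dom B k)"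
  define l where "l = (SOME l. l \<in> charts F \<and> q \<in> chart_dom F l)"
  have k: "k \<in> charts B" "p \<in> chart_dom B k"
    using someI[of "\<lambda>k. k \<in> charts B \<and> p \<in> chart_dom B k" i] i p by (auto simp: k_def)
  have l: "l \<in> charts F" "q \<in> chart_dom F l"
    using someI[of "\<lambda>l. l \<in> charts F \<and> q \<in> chart_dom F l" j] j q by (auto simp: l_def)
  have "gB i p a b = gB k p (local_differential B B id i k p a) (local_differential B B id i k p b)"
    for a b
    using m(3) i k p unfolding semi_riemannian_metric_def by blast
  moreover have "gF j q a b = gF l q (local_differential F F id j l q a) (local_differential F F id j l q b)"
    for a b
    using m(4) j l q unfolding semi_riemannian_metric_def by blast
  ultimately show ?thesis
    using local_differential_projections(1)[OF m(1,2) i j p q k]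
      local_differential_projections(2)[OF m(1,2) i j p q l]
    by (simp add: warped_metric_def pullback_def k_def[symmetric] l_def[symmetric])
qed

lemma ricci_trace:
  assumes "scalar_product (g i p)"
  shows "ricci M g i p v w = (\<Sum>e\<in>Basis. curv_op M g i p e v w \<bullet> e)"
  unfolding ricci_def curv_def by (rule metric_contraction[OF assms])

text \<open>
  Taking the trace identifies the factor of proportionality, so that a Ricci tensor pointwise
  proportional to the metric is already Einstein in the sense of \<^const>\<open>einstein\<close>.
\<close>

lemma scalar_curvature_proportional:
  fixes g :: "('i, 'a, 'e::euclidean_space) tensor2"
  assumes B: "scalar_product (g i p)" and l: "\<And>v w. ricci M g i p v w = l * g i p v w"
  shows "scalar_curvature M g i p = l * real DIM('e)"
proof -
  have "bilinear (g i p)"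
    using B by (simp add: scalar_product_def)
  then have "scalar_curvature M g i p = (\<Sum>a\<in>Basis. \<Sum>b\<in>Basis. inverse_metric (g i p) a b * g i p (l *\<^sub>R a) b)"
    by (simp add: scalar_curvature_def l bilinear_lmul)
  also have "\<dots> = (\<Sum>a\<in>Basis. (l *\<^sub>R a) \<bullet> (a::'e))"
    by (rule metric_contraction[OF B])
  finally show ?thesis by simp
qed

text \<open>
  The condition is tensorial, so it may be read in product charts. There the warped metric has its
  usual block form, and the fiber result of the previous section applies.
\<close>

lemma fiber_ricci_proportional_at:
  fixes B :: "('i, 'a, 'e::euclidean_space) manifold"
    and F :: "('j, 'b, 'f::euclidean_space) manifold"
  assumes B: "semi_riemannian_manifold B gB" and F: "semi_riemannian_manifold F gF"
    and f: "smooth_function B f" "\<forall>x\<in>topspace (man_top B). f x > 0"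
    and RR: "RR_eq_QSR (product_manifold B F) (warped_metric B F gB gF f)"
    and i: "i \<in> charts B" and j: "j \<in> charts F"
    and p: "p \<in> chart_dom B i" and q: "q \<in> chart_dom F j"
    and nonflat: "curv B gB i p a b c d \<noteq> 0"
  shows "\<exists>l. \<forall>v w. ricci F gF j q v w = l * gF j q v w"
proof -
  have mB: "smooth_manifold B" and mF: "smooth_manifold F"
    using B F by (auto simp: semi_riemannian_manifold_def)
  note cB = smooth_manifold_chart[OF mB i] and cF = smooth_manifold_chart[OF mF j]
  define U where "U = chart_img B i"
  define V where "V = chart_img F j"
  define g where "g = (\<lambda>z. gB i (chart_inv B i z))"
  define h where "h = (\<lambda>z. gF j (chart_inv F j z))"
  define \<phi> where "\<phi> = f \<circ> chart_inv B i"
  define x where "x = chart_map B i p"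
  define y where "y = chart_map F j q"
  interpret base: local_metric U g
    unfolding U_def g_def by (rule local_metric_chart[OF B i])
  interpret fiber: local_metric V h
    unfolding V_def h_def by (rule local_metric_chart[OF F j])
  have smooth: "smooth_on U \<phi>"
    using f(1) i by (simp add: smooth_function_def U_def \<phi>_def)
  interpret w: warped_charts U g V h \<phi>
  proof
    fix z assume z: "z \<in> U"
    then have "chart_inv B i z \<in> chart_dom B i"
      using cB by (simp add: U_def)
    moreover have "chart_dom B i \<subseteq> topspace (man_top B)"
      using mB i unfolding smooth_manifold_def by blast
    ultimately show "\<phi> z > 0"
      using f(2) by (auto simp: \<phi>_def)
  qed (use smooth_on_differentiable[OF smooth] in auto)
  define M where "M = product_manifold B F"
  define G where "G = warped_metric B F gB gF f"
  have x: "x \<in> U" and y: "y \<in> V" and xp: "chart_inv B i x = p" and yq: "chart_inv F j y = q"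
    using cB cF p q by (auto simp: x_def y_def U_def V_def)
  have G_eq: "G (i, j) (chart_inv M (i, j) z) = w.G z" if mem: "z \<in> U \<times> V" for z
  proof (intro ext)
    fix u v
    obtain s t where z: "z = (s, t)" "s \<in> chart_img B i" "t \<in> chart_img F j"
      using mem by (auto simp: U_def V_def)
    show "G (i, j) (chart_inv M (i, j) z) u v = w.G z u v"
      unfolding G_def M_def z(1) product_chart_inv[OF mB mF i j z(2,3)]
        warped_metric_product_chart[OF B F i j cB(4)[OF z(2)] cF(4)[OF z(3)]]
      by (simp only: w.G_def fst_conv snd_conv) (simp only: g_def h_def \<phi>_def o_apply)
  qed
  have curv_op_M: "curv_op M G (i, j) (p, q) = w.R x y"
  proof -
    have "chart_map M (i, j) (p, q) = (x, y)"
      by (simp add: M_def product_manifold_def x_def y_def)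
    then show ?thesis
      unfolding curv_op_def
      using curvature_operator_cong_open[OF w.open_UV _ G_eq, of "(x, y)"] x y by simp
  qed
  have G_pq: "G (i, j) (p, q) = w.G (x, y)"
    using G_eq[of "(x, y)"] x y product_chart_inv[OF mB mF i j, of x y]
    by (simp add: xp yq M_def U_def V_def)
  have curv_M: "curv M G (i, j) (p, q) = (\<lambda>u v w t. w.G (x, y) (w.R x y u v w) t)"
    by (intro ext) (simp add: curv_def curv_op_M G_pq)
  have "scalar_product (G (i, j) (p, q))"
    unfolding G_pq using x y by (intro w.scalar_product_G) simp
  then have ricci_M: "ricci M G (i, j) (p, q) = (\<lambda>v w. \<Sum>e\<in>Basis. w.R x y e v w \<bullet> e)"
    by (intro ext) (simp add: ricci_trace curv_op_M)
  have chart_pq: "(i, j) \<in> charts M" "(p, q) \<in> chart_dom M (i, j)"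
    using i j p q by (auto simp: M_def product_manifold_def)
  have nf: "g x (curvature_operator g x a b c) d \<noteq> 0"
    using nonflat by (simp add: curv_def curv_op_def g_def x_def[symmetric] xp)
  have "\<exists>l. \<forall>\<beta> \<alpha>. (\<Sum>e\<in>Basis. curvature_operator h y e \<beta> \<alpha> \<bullet> e) = l * h y \<beta> \<alpha>"
  proof (rule w.fiber_ricci_proportional[OF x y _ nf])
    fix Xs :: "('e \<times> 'f) list" and X Y :: "'e \<times> 'f" assume "length Xs = 4"
    then have "derivation_tensor (curv_op M G (i, j) (p, q)) (tensor4 (curv M G (i, j) (p, q))) Xs X Y =
        tachibana_tensor (ricci M G (i, j) (p, q)) (tensor4 (curv M G (i, j) (p, q))) Xs X Y"
      using RR chart_pq unfolding RR_eq_QSR_def M_def G_def by blast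
    then show "derivation_tensor (w.R x y) (tensor4 (\<lambda>u v w t. w.G (x, y) (w.R x y u v w) t)) Xs X Y =
      tachibana_tensor (\<lambda>v w. \<Sum>e\<in>Basis. w.R x y e v w \<bullet> e)
       (tensor4 (\<lambda>u v w t. w.G (x, y) (w.R x y u v w) t)) Xs X Y"
      unfolding curv_op_M curv_M ricci_M .
  qed
  moreover have "ricci F gF j q v w = (\<Sum>e\<in>Basis. curvature_operator h y e v w \<bullet> e)" for v w
    unfolding ricci_trace[where g = gF and i = j and p = q, OF metric_scalar_product[OF F j q]]
    by (simp add: curv_op_def h_def y_def)
  moreover have "h y = gF j q"
    by (simp add: h_def yq)
  ultimately show ?thesis by simp
qed

theorem theorem5p4:
  fixes B :: "('i, 'a, 'e::euclidean_space) manifold"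
    and F :: "('j, 'b, 'f::euclidean_space) manifold"
    and gB :: "('i, 'a, 'e) tensor2"
    and gF :: "('j, 'b, 'f) tensor2"
    and f :: "'a \<Rightarrow> real"
    and n p :: nat
  assumes "n \<ge> 3" and "1 \<le> p" and "p \<le> n - 1"
    and "DIM('e) = p" and "DIM('f) = n - p"
    and "semi_riemannian_manifold B gB"
    and "semi_riemannian_manifold F gF"
    and "smooth_function B f"
    and "\<forall>x\<in>topspace (man_top B). f x > 0"
    and "connected_space (man_top (product_manifold B F))"
    and "RR_eq_QSR (product_manifold B F) (warped_metric B F gB gF f)"
  shows "flat B gB \<or> einstein F gF"
proof (rule disjCI)
  assume "\<not> einstein F gF"
  show "flat B gB"
    unfolding flat_def
  proof (intro ballI allI, rule ccontr)
    fix i x a b c d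
    assume i: "i \<in> charts B" and x: "x \<in> chart_dom B i" and nonflat: "curv B gB i x a b c d \<noteq> 0"
    have "einstein F gF"
      unfolding einstein_def
    proof (intro ballI allI)
      fix j y v w assume j: "j \<in> charts F" and y: "y \<in> chart_dom F j"
      obtain l where l: "\<And>v w. ricci F gF j y v w = l * gF j y v w"
        using fiber_ricci_proportional_at[OF assms(6-9,11) i j x y nonflat] by blast
      then show "ricci F gF j y v w = scalar_curvature F gF j y / real DIM('f) * gF j y v w"
        using scalar_curvature_proportional[where g = gF and i = j and p = y,
            OF metric_scalar_product[OF assms(7) j y] l] by simp
    qed
    with \<open>\<not> einstein F gF\<close> show False by contradiction
  qed
qed

end
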